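(* Let $n\ge1$, $T>0$, let $S\subset[0,T]\times\mathbb{R}^n$ be compact with Euclidean distance function $d_S$, and let $b\colon[0,T]\times\mathbb{R}^n\to\mathbb{R}^n$ be a vector field. Suppose that for some $1\le p,q\le\infty$, $$b\cdot\nabla d_S\in L^p(0,T;L^q_{\mathrm{loc}}(\mathbb{R}^n))\quad\text{and}\quad d_S^{-1}\in L^{p^*}(0,T;L^{q^*}_{\mathrm{loc}}(\mathbb{R}^n)),$$ where $\frac1p+\frac1{p^*}=\frac1q+\frac1{q^*}=1$. If $X\colon[0,T]\times\mathbb{R}^n\to\mathbb{R}^n$ is a regular Lagrangian flow solution of $\frac{d\xi}{dt}=b(t,\xi)$, $\xi(0)=x$, then $X$ avoids $S$, that is $$\mu_n\big(\{x\in\mathbb{R}^n : (t,X(t,x))\in S\text{ for some }t\in[0,T]\}\big)=0.$$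
   Context: $\mu_n$ is $n$-dimensional Lebesgue measure; $\nabla$ is the gradient in the space variable $x$ only. Distance function: $d_S(t,x)=\inf_{(s,y)\in S}|(t,x)-(s,y)|$ (Euclidean norm of $\mathbb{R}^{n+1}$). It is Lipschitz, so $\nabla d_S$ exists almost everywhere. $f\in L^p(0,T;L^q_{\mathrm{loc}}(\mathbb{R}^n))$ means that for every compact $K\subset\mathbb{R}^n$ the map $t\mapsto\|f(t,\cdot)\|_{L^q(K)}$ is in $L^p(0,T)$. Regular Lagrangian flow: $X\colon[0,T]\times\mathbb{R}^n\to\mathbb{R}^n$ is a regular Lagrangian flow solution of the ODE if (a) for almost every $x\in\mathbb{R}^n$ the trajectory $t\mapsto X(t,x)$ is absolutely continuous and $X(t,x)=x+\int_0^t b(\tau,X(\tau,x))\,d\tau$; and (b) there is a constant $L>0$ such that for all Borel sets $B\subset\mathbb{R}^n$ and all $t\in[0,T]$, $\mu_n(X(t,\cdot)^{-1}(B))\le L\,\mu_n(B)$. *)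

theory Defs
  imports "HOL-Analysis.Analysis" "HOL-Probability.Essential_Supremum"
begin

text \<open>
  Exponents are of type \<^typ>\<open>ennreal\<close>, where \<open>1 / \<infinity> = 0\<close>. Functions are
  \<^typ>\<open>ereal\<close>-valued because \<open>d\<^sub>S\<^sup>-\<^sup>1\<close> takes the value \<open>\<infinity>\<close> on \<open>S\<close>
  (in \<^typ>\<open>real\<close> it would be \<open>0\<close> there).
\<close>

text \<open>Only used for exponents \<open>r > 0\<close>, so that \<open>\<infinity>\<^sup>r = \<infinity>\<close>.\<close>
definition ennreal_powr :: "ennreal \<Rightarrow> real \<Rightarrow> ennreal" where
  "ennreal_powr x r = (if x = top then top else ennreal (enn2real x powr r))"

definition Lp_norm :: "'a measure \<Rightarrow> ennreal \<Rightarrow> ('a \<Rightarrow> ereal) \<Rightarrow> ennreal" where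
  "Lp_norm M p f =
     (if p = top then esssup M (\<lambda>x. e2ennreal \<bar>f x\<bar>)
      else ennreal_powr (\<integral>\<^sup>+ x. ennreal_powr (e2ennreal \<bar>f x\<bar>) (enn2real p) \<partial>M) (1 / enn2real p))"

definition in_Lp :: "'a measure \<Rightarrow> ennreal \<Rightarrow> ('a \<Rightarrow> ereal) \<Rightarrow> bool" where
  "in_Lp M p f \<longleftrightarrow> f \<in> borel_measurable M \<and> Lp_norm M p f < top"

text \<open>
  The space \<open>L\<^sup>p(0,T; L\<^sup>q\<^sub>l\<^sub>o\<^sub>c)\<close>. As usual, its elements are (jointly) Lebesgue measurable
  functions on \<open>(0,T) \<times> \<real>\<^sup>n\<close>; almost every time section is then Lebesgue measurable.
\<close>
definition in_Lp_Lq_loc ::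
    "real \<Rightarrow> ennreal \<Rightarrow> ennreal \<Rightarrow> (real \<Rightarrow> 'a::euclidean_space \<Rightarrow> ereal) \<Rightarrow> bool" where
  "in_Lp_Lq_loc T p q f \<longleftrightarrow>
     (\<lambda>(t, x). f t x) \<in> borel_measurable (lebesgue_on ({0<..<T} \<times> UNIV)) \<and>
     (\<forall>K. compact K \<longrightarrow>
        in_Lp (lebesgue_on {0<..<T}) p (\<lambda>t. enn2ereal (Lp_norm (lebesgue_on K) q (f t))))"

text \<open>
  The gradient, with value \<open>0\<close> where it does not exist. For the space gradient of a Lipschitz
  function of \<open>(t, x)\<close> this choice affects only a Lebesgue null set.
\<close>
definition gradient :: "('a::real_inner \<Rightarrow> real) \<Rightarrow> 'a \<Rightarrow> 'a" where
  "gradient f x = (if \<exists>g. GDERIV f x :> g then THE g. GDERIV f x :> g else 0)"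

text \<open>
  The classical \<open>\<epsilon>\<close>-\<open>\<delta>\<close> definition; a division is a finite family of nonoverlapping compact
  intervals.
\<close>
definition absolutely_continuous_on :: "real set \<Rightarrow> (real \<Rightarrow> 'a::real_normed_vector) \<Rightarrow> bool" where
  "absolutely_continuous_on A f \<longleftrightarrow>
     (\<forall>\<epsilon>>0. \<exists>\<delta>>0. \<forall>D U. D division_of U \<and> U \<subseteq> A \<and> (\<Sum>I\<in>D. Sup I - Inf I) < \<delta> \<longrightarrow>
        (\<Sum>I\<in>D. norm (f (Sup I) - f (Inf I))) < \<epsilon>)"

text \<open>
  The explicit measurability and integrability conditions are what makes the integral in the
  first condition and the measure of the preimage in the second one meaningful.
\<close>
definition regular_Lagrangian_flow ::
    "real \<Rightarrow> (real \<Rightarrow> 'a::euclidean_space \<Rightarrow> 'a) \<Rightarrow> (real \<Rightarrow> 'a \<Rightarrow> 'a) \<Rightarrow> bool" where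
  "regular_Lagrangian_flow T b X \<longleftrightarrow>
     (AE x in lebesgue.
        absolutely_continuous_on {0..T} (\<lambda>t. X t x) \<and>
        set_integrable lebesgue {0..T} (\<lambda>\<tau>. b \<tau> (X \<tau> x)) \<and>
        (\<forall>t\<in>{0..T}. X t x = x + (LINT \<tau>:{0..t}|lebesgue. b \<tau> (X \<tau> x)))) \<and>
     (\<exists>L::real. L > 0 \<and>
        (\<forall>B\<in>sets borel. \<forall>t\<in>{0..T}.
           X t -` B \<in> sets lebesgue \<and>
           emeasure lebesgue (X t -` B) \<le> ennreal L * emeasure lebesgue B))"

end

theory Submission
  imports Defs
begin

text \<open>
  Along a trajectory \<open>z(t) = (t, X(t,x))\<close> one has, formally,
  \<open>|d/dt ln d\<^sub>S(z(t))| \<le> (1 + |b \<bullet> \<nabla>d\<^sub>S|) / d\<^sub>S\<close>, and by compressibility and Hoelder's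
  inequality the right-hand side is integrable in \<open>t\<close> for almost every \<open>x\<close>. So \<open>d\<^sub>S\<close> is positive at
  some time, and \<open>ln d\<^sub>S\<close>, having bounded variation, cannot reach \<open>-\<infinity>\<close>.

  Neither Rademacher's theorem nor differentiation in \<open>t\<close> is needed. The distance to a compact
  set is differentiable off the set wherever the nearest point is unique, and nearest points are
  monotone along lines, so uniqueness fails at only countably many points of each line in a
  coordinate direction, as far as that coordinate of the nearest point is concerned. The bound on
  \<open>ln d\<^sub>S\<close> is integrated by Riemann sums from the one-sided inequality
  \<open>d(y) - d(z) \<le> \<nabla>d(z) \<bullet> (y - z) + |y - z|\<^sup>2 / (2 d(z))\<close>.
\<close>

section \<open>Nearest points and the gradient of the distance\<close>

text \<open>No regularity of \<open>b\<close> is assumed, and what is known of its pairing with the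
  space gradient holds only up to null sets of space-time. Compressibility makes such information
  usable along trajectories: almost every trajectory meets a given null set of space-time only at a
  null set of times. The points with several nearest points form such a null set, so along almost
  every trajectory the gradient exists at almost every time at which the trajectory is off
  \<open>S\<close>.

  The gradient that governs the curve is the one in space-time. It has length 1, so its time
  component contributes at most 1, which is the origin of the summand 1 in the formal bound; its
  space component is the gradient in the hypothesis. The two summands are integrable for the same
  reason: the constant 1 also lies in the mixed space with exponents \<open>p\<close> and
  \<open>q\<close>, so Hoelder's inequality against the inverse distance is used twice.
  Integrability of the inverse distance along a trajectory also excludes that the trajectory stays
  in \<open>S\<close> throughout.\<close>

lemma dist_closest_point_infdist:
  assumes "closed S" "S \<noteq> {}"
  shows "dist z (closest_point S z) = infdist z S"
  using setdist_closest_point[OF assms] by (simp add: infdist_eq_setdist)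

text \<open>The unit vector pointing from a nearest point to \<open>z\<close>. If there are several
  nearest points it depends on the choice made by \<open>closest_point\<close>, and on a nonempty
  closed \<open>S\<close> it is 0; the one-sided estimates below hold for whichever nearest point is
  chosen.\<close>

definition dist_grad :: "'a::euclidean_space set \<Rightarrow> 'a \<Rightarrow> 'a" where
  "dist_grad S z = (z - closest_point S z) /\<^sub>R infdist z S"

lemma norm_dist_grad:
  assumes "closed S" "S \<noteq> {}" "infdist z S > 0"
  shows "norm (dist_grad S z) = 1"
  using assms dist_closest_point_infdist[OF assms(1,2), of z]
  by (simp add: dist_grad_def dist_norm)

text \<open>The distance to the single point \<open>closest_point S z\<close> dominates
  \<open>infdist\<close> everywhere and agrees with it at \<open>z\<close>, so it suffices to expand
  this smooth function. The nearest point of \<open>z\<close> need not be unique.\<close>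

lemma infdist_diff_le_dist_grad:
  assumes "closed S" "S \<noteq> {}" and pos: "infdist z S > 0"
  shows "infdist y S - infdist z S
    \<le> dist_grad S z \<bullet> (y - z) + (norm (y - z))\<^sup>2 / (2 * infdist z S)"
proof -
  define w where "w = z - closest_point S z"
  define d where "d = infdist z S"
  have d: "d > 0" "norm w = d"
    using pos dist_closest_point_infdist[OF assms(1,2), of z] by (simp_all add: d_def w_def dist_norm)
  have sq: "(norm (w + (y - z)))\<^sup>2 = d\<^sup>2 + 2 * (w \<bullet> (y - z)) + (norm (y - z))\<^sup>2"
    unfolding d(2)[symmetric] power2_norm_eq_inner by (simp add: inner_add_left inner_add_right inner_commute)
  have "infdist y S \<le> dist y (closest_point S z)"
    by (rule infdist_le) (use closest_point_in_set assms in auto)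
  also have "\<dots> = norm (w + (y - z))"
    by (simp add: w_def dist_norm)
  finally have 1: "infdist y S \<le> norm (w + (y - z))" .
  \<comment> \<open>Dividing the expanded square by \<open>2 * d\<close> bounds the norm by the
    tangent of the square root at the square of \<open>d\<close>, which produces the denominator
    \<open>2 * infdist z S\<close>.\<close>
  have "0 \<le> (norm (w + (y - z)) - d)\<^sup>2" by simp
  also have "\<dots> = 2 * (w \<bullet> (y - z)) + (norm (y - z))\<^sup>2 - 2 * d * (norm (w + (y - z)) - d)"
    unfolding power2_diff sq by (simp add: right_diff_distrib power2_eq_square)
  finally have "2 * d * (norm (w + (y - z)) - d) \<le> 2 * (w \<bullet> (y - z)) + (norm (y - z))\<^sup>2" by simp
  hence "norm (w + (y - z)) - d \<le> (2 * (w \<bullet> (y - z)) + (norm (y - z))\<^sup>2) / (2 * d)"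
    using d(1) by (simp add: pos_le_divide_eq mult.commute)
  also have "\<dots> = (w \<bullet> (y - z)) / d + (norm (y - z))\<^sup>2 / (2 * d)"
    by (simp add: add_divide_distrib)
  also have "(w \<bullet> (y - z)) / d = dist_grad S z \<bullet> (y - z)"
    unfolding dist_grad_def w_def[symmetric] d_def[symmetric] by (simp add: divide_inverse mult.commute)
  finally show ?thesis using 1 by (simp add: d_def)
qed

text \<open>No point of \<open>S\<close> belongs to this set, since there the distance is 0 and the
  point itself is the only nearest one.\<close>

definition multi_nearest :: "'a::metric_space set \<Rightarrow> 'a set" where
  "multi_nearest S =
     {z. \<exists>s\<in>S. \<exists>s'\<in>S. s \<noteq> s' \<and> dist z s = infdist z S \<and> dist z s' = infdist z S}"

text \<open>Outside a neighbourhood \<open>U\<close> of the unique nearest point, the closed set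
  \<open>S - U\<close> is strictly farther from \<open>z\<close> than \<open>S\<close> is. Both
  distances are continuous, so the gap persists near \<open>z\<close> and forces every nearest point
  of a nearby \<open>y\<close> into \<open>U\<close>, even where the choice is not unique.\<close>

lemma isCont_closest_point:
  fixes S :: "'a::euclidean_space set"
  assumes S: "compact S" "S \<noteq> {}" and z: "z \<notin> multi_nearest S"
  shows "isCont (closest_point S) z"
  unfolding isCont_def
proof (rule topological_tendstoI)
  fix U assume U: "open U" "closest_point S z \<in> U"
  have cl: "closed S" using S by (simp add: compact_imp_closed)
  have attained: "dist y (closest_point S y) = infdist y S" "closest_point S y \<in> S" for y
    using dist_closest_point_infdist[OF cl S(2)] closest_point_in_set[OF cl S(2)] by auto
  show "\<forall>\<^sub>F y in at z. closest_point S y \<in> U"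
  proof (cases "S - U = {}")
    case True
    then show ?thesis using attained by (auto intro!: always_eventually)
  next
    case False
    obtain k where k: "k \<in> S - U" "infdist z (S - U) = dist z k"
      by (rule infdist_attains_inf[OF closed_Diff[OF cl U(1)] False])
    have "k \<noteq> closest_point S z" using k U by auto
    then have "dist z k \<noteq> infdist z S"
      using z k(1) attained[of z] unfolding multi_nearest_def mem_Collect_eq by (metis DiffD1)
    moreover have "infdist z S \<le> dist z k"
      using k by (intro infdist_le) auto
    ultimately have "infdist z S < infdist z (S - U)"
      using k by simp
    moreover have "((\<lambda>y. infdist y (S - U) - infdist y S) \<longlongrightarrow> infdist z (S - U) - infdist z S) (at z)"
      by (intro tendsto_intros)
    ultimately have "\<forall>\<^sub>F y in at z. infdist y (S - U) - infdist y S > 0"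
      by (intro order_tendstoD) auto
    then show ?thesis
    proof eventually_elim
      case (elim y)
      then have "closest_point S y \<notin> S - U"
        using infdist_le[of "closest_point S y" "S - U" y] attained[of y] by force
      then show ?case using attained by auto
    qed
  qed
qed

lemma isCont_dist_grad:
  fixes S :: "'a::euclidean_space set"
  assumes "compact S" "S \<noteq> {}" "z \<notin> multi_nearest S" "infdist z S > 0"
  shows "isCont (dist_grad S) z"
proof -
  have "isCont (\<lambda>y. (y - closest_point S y) /\<^sub>R infdist y S) z"
    using assms by (intro continuous_intros isCont_closest_point) (auto simp: )
  then show ?thesis by (simp add: dist_grad_def[abs_def])
qed

text \<open>The one-sided expansion at \<open>z\<close> bounds the increment from above; the
  expansion at \<open>y\<close>, read backwards, bounds it from below with the gradient at
  \<open>y\<close>. Continuity of \<open>dist_grad\<close> at \<open>z\<close> closes the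
  difference.\<close>

lemma GDERIV_infdist:
  fixes S :: "'a::euclidean_space set"
  assumes S: "compact S" "S \<noteq> {}" and z: "z \<notin> multi_nearest S" "infdist z S > 0"
  shows "GDERIV (\<lambda>y. infdist y S) z :> dist_grad S z"
proof -
  let ?g = "dist_grad S" and ?d = "\<lambda>y. infdist y S"
  have cl: "closed S" using S by (simp add: compact_imp_closed)
  \<comment> \<open>The two quadratic errors and the change of the gradient, each divided by
    \<open>norm (y - z)\<close>.\<close>
  define B where "B y = norm (y - z) / (2 * ?d z) + norm (y - z) / (2 * ?d y) + norm (?g y - ?g z)" for y
  have dlim: "(?d \<longlongrightarrow> ?d z) (at z)"
    by (intro tendsto_intros)
  have glim: "(?g \<longlongrightarrow> ?g z) (at z)"
    using isCont_dist_grad[OF S z] by (simp add: isCont_def)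
  have B0: "(B \<longlongrightarrow> norm (z - z) / (2 * ?d z) + norm (z - z) / (2 * ?d z) + norm (?g z - ?g z)) (at z)"
    unfolding B_def using z(2) by (intro tendsto_intros dlim glim) auto
  have ev: "\<forall>\<^sub>F y in at z. norm ((?d y - ?d z - (y - z) \<bullet> ?g z) / norm (y - z)) \<le> B y"
    using order_tendstoD(1)[OF dlim z(2)] eventually_neq_at_within[of z]
  proof eventually_elim
    case (elim y)
    define r where "r = norm (y - z)"
    have r: "r > 0" using elim by (simp add: r_def)
    have 1: "?d y - ?d z - (y - z) \<bullet> ?g z \<le> r * (r / (2 * ?d z))"
      using infdist_diff_le_dist_grad[OF cl S(2) z(2), of y]
      by (simp add: r_def inner_commute power2_eq_square)
    have "?d z - ?d y \<le> ?g y \<bullet> (z - y) + (norm (z - y))\<^sup>2 / (2 * ?d y)"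
      using infdist_diff_le_dist_grad[OF cl S(2) elim(1), of z] .
    then have "(y - z) \<bullet> ?g z - (?d y - ?d z) \<le> (?g z - ?g y) \<bullet> (y - z) + r * (r / (2 * ?d y))"
      by (simp add: r_def inner_diff_left inner_diff_right inner_commute power2_eq_square norm_minus_commute)
    also have "(?g z - ?g y) \<bullet> (y - z) \<le> norm (?g y - ?g z) * r"
      using norm_cauchy_schwarz[of "?g z - ?g y" "y - z"] by (simp add: r_def norm_minus_commute)
    finally have 2: "(y - z) \<bullet> ?g z - (?d y - ?d z) \<le> r * (norm (?g y - ?g z) + r / (2 * ?d y))"
      by (simp add: algebra_simps)
    have "\<bar>?d y - ?d z - (y - z) \<bullet> ?g z\<bar> \<le> r * B y"
    proof -
      have "r * (r / (2 * ?d z)) \<le> r * B y"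
        unfolding B_def r_def[symmetric] using elim r z by (intro mult_left_mono) auto
      moreover have "r * (norm (?g y - ?g z) + r / (2 * ?d y)) \<le> r * B y"
        unfolding B_def r_def[symmetric] using elim r z by (intro mult_left_mono) auto
      ultimately show ?thesis using 1 2 by linarith
    qed
    then show ?case using r by (simp add: field_simps flip: r_def)
  qed
  have "((\<lambda>y. (?d y - ?d z - (y - z) \<bullet> ?g z) / norm (y - z)) \<longlongrightarrow> 0) (at z)"
    by (rule Lim_null_comparison[OF ev]) (use B0 in simp)
  then show ?thesis
    unfolding gderiv_def has_derivative_iff_norm
    by (auto simp: bounded_linear_inner_left tendsto_norm_zero_iff dest: tendsto_norm_zero)
qed


text \<open>Averaging the measures of the translates \<open>N - r *\<^sub>R e\<close> over \<open>r \<in> [0,1]\<close> reduces this to lines.\<close>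
lemma null_sets_countable_line_sections:
  fixes N :: "'a::euclidean_space set"
  assumes N: "N \<in> sets borel" and count: "\<And>z. countable {r. z + r *\<^sub>R e \<in> N}"
  shows "N \<in> null_sets lborel"
proof -
  note [measurable] = N
  have "emeasure lborel N = (\<integral>\<^sup>+ r. indicator {0..1::real} r * emeasure lborel N \<partial>lborel)"
    by (simp add: nn_integral_multc)
  also have "\<dots> = (\<integral>\<^sup>+ r. \<integral>\<^sup>+ z. indicator {0..1} r * indicator N (r *\<^sub>R e + z) \<partial>lborel \<partial>lborel)"
  proof (rule nn_integral_cong)
    fix r :: real
    have "emeasure lborel N = (\<integral>\<^sup>+ z. indicator N z \<partial>distr lborel borel ((+) (r *\<^sub>R e)))"
      by (subst lborel_distr_plus) simp
    also have "\<dots> = (\<integral>\<^sup>+ z. indicator N (r *\<^sub>R e + z) \<partial>lborel)"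
      by (subst nn_integral_distr) auto
    finally show "indicator {0..1} r * emeasure lborel N
        = (\<integral>\<^sup>+ z. indicator {0..1} r * indicator N (r *\<^sub>R e + z) \<partial>lborel)"
      by (simp add: nn_integral_cmult)
  qed
  also have "\<dots> = (\<integral>\<^sup>+ z. \<integral>\<^sup>+ r. indicator {0..1} r * indicator N (r *\<^sub>R e + z) \<partial>lborel \<partial>lborel)"
    by (rule lborel_pair.Fubini') measurable
  also have "\<dots> = (\<integral>\<^sup>+ (z::'a). 0 \<partial>lborel)"
  proof (rule nn_integral_cong)
    fix z :: 'a
    have "AE r in lborel. r \<notin> {r. z + r *\<^sub>R e \<in> N}"
      by (rule AE_not_in) (use countable_imp_null_set_lborel[OF count] in auto)
    then have "AE r in lborel. indicator {0..1} r * indicator N (r *\<^sub>R e + z) = (0::ennreal)"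
      by eventually_elim (auto simp: indicator_def add.commute)
    then show "(\<integral>\<^sup>+ r. indicator {0..1} r * indicator N (r *\<^sub>R e + z) \<partial>lborel) = 0"
      by (subst nn_integral_cong_AE[where v="\<lambda>_. 0"]) auto
  qed
  finally show ?thesis using N by (auto intro: null_setsI)
qed

text \<open>Each point is at most as far from its own nearest point as from that of the other. In
  the sum of the two squared inequalities all squares cancel and twice the inner product
  remains.\<close>

lemma nearest_pair_monotone:
  fixes z z' :: "'a::real_inner"
  assumes "s \<in> S" "s' \<in> S" "dist z s = infdist z S" "dist z' s' = infdist z' S"
  shows "(z' - z) \<bullet> (s' - s) \<ge> 0"
proof -
  have "dist z s \<le> dist z s'" "dist z' s' \<le> dist z' s"
    using assms by (auto intro: infdist_le)
  then have "(dist z s)\<^sup>2 \<le> (dist z s')\<^sup>2" "(dist z' s')\<^sup>2 \<le> (dist z' s)\<^sup>2"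
    by (auto intro: power_mono)
  then show ?thesis
    unfolding dist_norm power2_norm_eq_inner
    by (simp add: inner_diff_left inner_diff_right inner_commute)
qed

lemma multi_nearest_null_sets:
  fixes S :: "'a::euclidean_space set"
  assumes S: "compact S"
  shows "multi_nearest S \<in> null_sets lborel"
proof -
  define P where "P z = {s\<in>S. dist z s = infdist z S}" for z
  define M where "M e = {z. \<exists>s\<in>P z. \<exists>s'\<in>P z. s \<bullet> e < s' \<bullet> e}" for e
  have U: "multi_nearest S = (\<Union>e\<in>Basis. M e)"
  proof -
    have "(s \<noteq> s') \<longleftrightarrow> (\<exists>e\<in>Basis. s \<bullet> e < s' \<bullet> e \<or> s' \<bullet> e < s \<bullet> e)" for s s' :: 'a
      by (auto simp: euclidean_eq_iff[of s s'] neq_iff)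
    then show ?thesis
      unfolding multi_nearest_def M_def P_def by (auto; blast)
  qed
  have M: "M e \<in> null_sets lborel" for e
  proof (rule null_sets_countable_line_sections[where e = e])
    \<comment> \<open>Requiring a gap of at least \<open>inverse (real (Suc k))\<close> instead of a
      strict inequality makes the condition closed, and projecting away the compact factor
      \<open>S \<times> S\<close> keeps it closed. So \<open>M e\<close> is a countable union of
      closed sets, which gives the Borel measurability needed for Fubini.\<close>
    define C where "C k = {z. \<exists>p. p \<in> S \<times> S \<and>
      (p, z) \<in> {(p, z). dist z (fst p) = infdist z S \<and> dist z (snd p) = infdist z S
          \<and> snd p \<bullet> e - fst p \<bullet> e \<ge> inverse (real (Suc k))}}" for k
    have "closed (C k)" for k
      unfolding C_def
      by (intro closed_compact_projection compact_Times S)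
        (auto simp: case_prod_beta' intro!: closed_Collect_conj closed_Collect_eq closed_Collect_le continuous_intros)
    moreover have "M e = (\<Union>k. C k)"
    proof -
      have arch: "a < b \<longleftrightarrow> (\<exists>k. inverse (real (Suc k)) \<le> b - a)" for a b :: real
      proof
        assume "a < b"
        then show "\<exists>k. inverse (real (Suc k)) \<le> b - a"
          using reals_Archimedean[of "b - a"] by (auto intro: less_imp_le)
      next
        assume "\<exists>k. inverse (real (Suc k)) \<le> b - a"
        then obtain k where "inverse (real (Suc k)) \<le> b - a" ..
        moreover have "inverse (real (Suc k)) > 0" by simp
        ultimately show "a < b" by linarith
      qed
      have "C k = {z. \<exists>s\<in>S. \<exists>s'\<in>S. dist z s = infdist z S \<and> dist z s' = infdist z S
          \<and> inverse (real (Suc k)) \<le> s' \<bullet> e - s \<bullet> e}" for k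
        unfolding C_def by (simp add: split_paired_Ex Bex_def; blast)
      then show ?thesis unfolding M_def P_def arch by blast
    qed
    ultimately show "M e \<in> sets borel" by (auto intro: borel_closed)
  next
    fix z
    define R where "R = {r. z + r *\<^sub>R e \<in> M e}"
    \<comment> \<open>At each bad point of the line the nearest points span an interval of
      \<open>e\<close>-coordinates. By monotonicity intervals of different points do not overlap, so
      a rational number inside each of them labels the points injectively.\<close>
    have "\<forall>r\<in>R. \<exists>q\<in>\<rat>. \<exists>s\<in>P (z + r *\<^sub>R e). \<exists>s'\<in>P (z + r *\<^sub>R e). s \<bullet> e < q \<and> q < s' \<bullet> e"
      unfolding R_def M_def using Rats_dense_in_real by blast
    then obtain q where q: "\<And>r. r \<in> R \<Longrightarrow> q r \<in> \<rat> \<and> (\<exists>s\<in>P (z + r *\<^sub>R e). \<exists>s'\<in>P (z + r *\<^sub>R e). s \<bullet> e < q r \<and> q r < s' \<bullet> e)"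
      by metis
    have less: "q r < q r'" if r: "r \<in> R" "r' \<in> R" "r < r'" for r r'
    proof -
      obtain s where s: "s \<in> P (z + r *\<^sub>R e)" "q r < s \<bullet> e" using q r by blast
      obtain s' where s': "s' \<in> P (z + r' *\<^sub>R e)" "s' \<bullet> e < q r'" using q r by blast
      have "(z + r' *\<^sub>R e - (z + r *\<^sub>R e)) \<bullet> (s' - s) \<ge> 0"
        using s s' unfolding P_def by (intro nearest_pair_monotone[of _ S]) auto
      then have "(r' - r) * (e \<bullet> (s' - s)) \<ge> 0"
        by (simp add: algebra_simps inner_diff_left inner_diff_right)
      then have "e \<bullet> (s' - s) \<ge> 0" using r by (simp add: zero_le_mult_iff)
      then show ?thesis using s s' by (simp add: inner_diff_right inner_commute)
    qed
    have "inj_on q R"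
      using less by (intro inj_onI) (metis less_irrefl linorder_neqE)
    moreover have "q ` R \<subseteq> \<rat>" using q by auto
    ultimately have "countable R"
      using countable_rat by (meson countable_image_inj_on countable_subset)
    then show "countable {r. z + r *\<^sub>R e \<in> M e}" by (simp add: R_def)
  qed
  show ?thesis
    unfolding U by (intro null_sets_UN' countable_finite finite_Basis M)
qed

section \<open>The logarithm of the distance along a curve\<close>

definition log_dist_grad :: "'a::euclidean_space set \<Rightarrow> 'a \<Rightarrow> 'a" where
  "log_dist_grad S z = dist_grad S z /\<^sub>R infdist z S"

text \<open>Concavity of \<open>ln\<close> preserves the direction of the one-sided estimate. The
  lower bound \<open>c\<close> makes the quadratic error uniform along a curve that stays away from
  \<open>S\<close>.\<close>

lemma ln_infdist_diff_le:
  assumes "closed S" "S \<noteq> {}" and c: "0 < c" "c \<le> infdist z S" and y: "infdist y S > 0"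
  shows "ln (infdist y S) - ln (infdist z S)
    \<le> log_dist_grad S z \<bullet> (y - z) + (norm (y - z))\<^sup>2 / (2 * c\<^sup>2)"
proof -
  let ?d = "infdist z S"
  have d: "?d > 0" using c by simp
  have "ln (infdist y S) - ln ?d \<le> (infdist y S - ?d) / ?d"
    using ln_diff_le[of "infdist y S" ?d] d y by simp
  also have "\<dots> \<le> (dist_grad S z \<bullet> (y - z) + (norm (y - z))\<^sup>2 / (2 * ?d)) / ?d"
    using infdist_diff_le_dist_grad[OF assms(1,2) d, of y] d by (intro divide_right_mono) auto
  also have "\<dots> = (dist_grad S z \<bullet> (y - z)) / ?d + (norm (y - z))\<^sup>2 / (2 * ?d\<^sup>2)"
    by (simp add: add_divide_distrib power2_eq_square)
  also have "(dist_grad S z \<bullet> (y - z)) / ?d = log_dist_grad S z \<bullet> (y - z)"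
    by (simp add: log_dist_grad_def divide_inverse mult.commute)
  also have "(norm (y - z))\<^sup>2 / (2 * ?d\<^sup>2) \<le> (norm (y - z))\<^sup>2 / (2 * c\<^sup>2)"
    using c by (intro divide_left_mono mult_left_mono power_mono) auto
  finally show ?thesis by simp
qed

text \<open>
  The Riemann sums are tagged at left end points for \<open>\<sigma> = 1\<close> and at right end points for
  \<open>\<sigma> = -1\<close>; the second summand of \<open>w\<close> absorbs the quadratic error and tends to \<open>0\<close>.
\<close>
lemma ln_infdist_along_curve:
  fixes S :: "'a::euclidean_space set" and z v :: "real \<Rightarrow> 'a" and m :: "real \<Rightarrow> ennreal"
  assumes S: "compact S" "S \<noteq> {}" and ab: "a < b"
    and v: "set_integrable lebesgue {a..b} v"
    and incr: "\<And>s t. a \<le> s \<Longrightarrow> s \<le> t \<Longrightarrow> t \<le> b \<Longrightarrow> z t - z s = (LINT \<tau>:{s<..t}|lebesgue. v \<tau>)"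
    and cont: "continuous_on {a..b} z"
    and pos: "\<And>t. t \<in> {a..b} \<Longrightarrow> infdist (z t) S > 0"
    and uniq: "AE \<tau> in lebesgue. \<tau> \<in> {a..b} \<longrightarrow> z \<tau> \<notin> multi_nearest S"
    and m: "AE \<tau> in lebesgue. \<tau> \<in> {a..b} \<longrightarrow> ennreal \<bar>log_dist_grad S (z \<tau>) \<bullet> v \<tau>\<bar> \<le> m \<tau>"
    and C: "(\<integral>\<^sup>+\<tau>. indicator {a..b} \<tau> * m \<tau> \<partial>lebesgue) \<le> ennreal C" "0 \<le> C"
    and \<sigma>: "\<sigma> = 1 \<or> \<sigma> = - 1"
  shows "\<sigma> * (ln (infdist (z b) S) - ln (infdist (z a) S)) \<le> C"
proof -
  have cl: "closed S" using S by (simp add: compact_imp_closed)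
  let ?g = "\<lambda>t. infdist (z t) S"
  let ?W = "\<lambda>t. log_dist_grad S (z t)"
  have gcont: "continuous_on {a..b} ?g"
    by (intro continuous_intros cont)
  \<comment> \<open>A uniform lower bound on the compact interval: it controls the quadratic error
    in each step and the size of \<open>log_dist_grad\<close> in the domination.\<close>
  obtain c where c: "c > 0" "\<And>t. t \<in> {a..b} \<Longrightarrow> c \<le> ?g t"
  proof -
    obtain t0 where "t0 \<in> {a..b}" "\<And>t. t \<in> {a..b} \<Longrightarrow> ?g t0 \<le> ?g t"
      using continuous_attains_inf[OF _ _ gcont] ab by auto
    then show thesis using pos that by blast
  qed
  obtain D where D: "D \<ge> 0" "\<And>t. t \<in> {a..b} \<Longrightarrow> norm (z t) \<le> D"
  proof -
    have "bounded (z ` {a..b})"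
      by (intro compact_imp_bounded compact_continuous_image cont) simp
    then obtain D where "\<forall>x\<in>z ` {a..b}. norm x \<le> D"
      unfolding bounded_iff by blast
    then show thesis using that[of D] ab by (smt (verit) atLeastAtMost_iff image_eqI norm_ge_zero)
  qed
  define pt where "pt k i = a + real i * (b - a) / real (Suc k)" for k i
  define tag where "tag k i = (if \<sigma> = 1 then pt k i else pt k (Suc i))" for k i
  define w where "w k i = \<sigma> *\<^sub>R ?W (tag k i) + (z (pt k (Suc i)) - z (pt k i)) /\<^sub>R (2 * c\<^sup>2)" for k i
  \<comment> \<open>By \<open>incr\<close> each increment of \<open>z\<close> is an integral of
    \<open>v\<close>, so the weights can be moved under the integral sign and the whole Riemann sum
    is the integral of \<open>f k\<close>. Its limit then requires only continuity of
    \<open>z\<close>.\<close>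
  define f where "f k \<tau> = (\<Sum>i<Suc k. w k i \<bullet> (indicator {pt k i<..pt k (Suc i)} \<tau> *\<^sub>R v \<tau>))" for k \<tau>
  have pt_le: "pt k i \<le> pt k (Suc i)" for k i
    using ab by (simp add: pt_def divide_right_mono)
  have pt_in: "pt k i \<in> {a..b}" if "i \<le> Suc k" for k i
  proof -
    have "real i * (b - a) \<le> real (Suc k) * (b - a)"
      using ab that by (intro mult_right_mono) auto
    then have "real i * (b - a) / real (Suc k) \<le> b - a"
      by (simp add: divide_le_eq mult.commute)
    then show ?thesis using ab by (simp add: pt_def)
  qed
  have intg: "integrable lebesgue (\<lambda>\<tau>. indicator {pt k i<..pt k (Suc i)} \<tau> *\<^sub>R v \<tau>)" if i: "i < Suc k" for k i
  proof -
    have "{pt k i<..pt k (Suc i)} \<subseteq> {a..b}"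
      using pt_in[of i k] pt_in[of "Suc i" k] i by auto
    then show ?thesis
      unfolding set_integrable_def[symmetric] by (intro set_integrable_subset[OF v]) auto
  qed
  have f_int: "integrable lebesgue (f k)" for k
    unfolding f_def[abs_def] using intg by (intro Bochner_Integration.integrable_sum integrable_inner_right) auto
  have below: "\<sigma> * (ln (?g b) - ln (?g a)) \<le> (LINT \<tau>|lebesgue. f k \<tau>)" for k
  proof -
    have "\<sigma> * (ln (?g b) - ln (?g a)) = (\<Sum>i<Suc k. \<sigma> * (ln (?g (pt k (Suc i))) - ln (?g (pt k i))))"
      unfolding sum_distrib_left[symmetric] sum_lessThan_telescope[of "\<lambda>i. ln (?g (pt k i))"]
      by (simp add: pt_def)
    also have "\<dots> \<le> (\<Sum>i<Suc k. w k i \<bullet> (z (pt k (Suc i)) - z (pt k i)))"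
    proof (rule sum_mono)
      fix i assume "i \<in> {..<Suc k}"
      then have in12: "pt k i \<in> {a..b}" "pt k (Suc i) \<in> {a..b}"
        using pt_in[of i k] pt_in[of "Suc i" k] by auto
      let ?D = "z (pt k (Suc i)) - z (pt k i)"
      have eq: "w k i \<bullet> ?D = \<sigma> * (?W (tag k i) \<bullet> ?D) + (norm ?D)\<^sup>2 / (2 * c\<^sup>2)"
        unfolding w_def inner_add_left inner_scaleR_left power2_norm_eq_inner
        by (simp only: divide_inverse mult.commute)
      show "\<sigma> * (ln (?g (pt k (Suc i))) - ln (?g (pt k i))) \<le> w k i \<bullet> ?D"
      proof (cases "\<sigma> = 1")
        case True
        then show ?thesis
          using ln_infdist_diff_le[OF cl S(2) c(1) c(2)[OF in12(1)] pos[OF in12(2)]]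
          unfolding eq by (simp add: tag_def)
      next
        case False
        then have "\<sigma> = - 1" using \<sigma> by simp
        then show ?thesis
          using ln_infdist_diff_le[OF cl S(2) c(1) c(2)[OF in12(2)] pos[OF in12(1)]]
          unfolding eq by (simp add: tag_def norm_minus_commute inner_diff_right)
      qed
    qed
    also have "\<dots> = (\<Sum>i<Suc k. LINT \<tau>|lebesgue. w k i \<bullet> (indicator {pt k i<..pt k (Suc i)} \<tau> *\<^sub>R v \<tau>))"
    proof (rule sum.cong[OF refl])
      fix i assume "i \<in> {..<Suc k}"
      then have i: "i < Suc k" by simp
      have eq: "z (pt k (Suc i)) - z (pt k i) = (LINT \<tau>|lebesgue. indicator {pt k i<..pt k (Suc i)} \<tau> *\<^sub>R v \<tau>)"
        using incr[of "pt k i" "pt k (Suc i)"] pt_in[of i k] pt_in[of "Suc i" k] pt_le[of k i] i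
        by (simp add: set_lebesgue_integral_def)
      show "w k i \<bullet> (z (pt k (Suc i)) - z (pt k i)) =
          (LINT \<tau>|lebesgue. w k i \<bullet> (indicator {pt k i<..pt k (Suc i)} \<tau> *\<^sub>R v \<tau>))"
        unfolding eq by (rule integral_inner_right[symmetric]) (rule intg[OF i])
    qed
    also have "\<dots> = (LINT \<tau>|lebesgue. f k \<tau>)"
      unfolding f_def using intg by (intro Bochner_Integration.integral_sum[symmetric] integrable_inner_right) auto
    finally show ?thesis .
  qed
  \<comment> \<open>At any time exactly one summand survives. Only the position of the sample times
    within one mesh width matters, both for the domination and for the limit.\<close>
  have rep: "\<exists>p q r. {p, q, r} \<subseteq> {a..b} \<inter> cball \<tau> ((b - a) / real (Suc k)) \<and>
      f k \<tau> = (\<sigma> *\<^sub>R ?W p + (z r - z q) /\<^sub>R (2 * c\<^sup>2)) \<bullet> v \<tau>" if \<tau>: "\<tau> \<in> {a<..b}" for k \<tau>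
  proof -
    define h where "h = (b - a) / real (Suc k)"
    have h: "h > 0" using ab by (simp add: h_def)
    have pt: "pt k i = a + real i * h" for i by (simp add: pt_def h_def)
    \<comment> \<open>The cells are open on the left, so a partition point belongs to the cell that
      ends there; hence the ceiling minus one and not the floor.\<close>
    define i where "i = nat (\<lceil>(\<tau> - a) / h\<rceil> - 1)"
    have "\<lceil>(\<tau> - a) / h\<rceil> \<ge> 1" using \<tau> h by simp
    then have i: "real i = of_int \<lceil>(\<tau> - a) / h\<rceil> - 1" by (simp add: i_def)
    have "real i < (\<tau> - a) / h" "(\<tau> - a) / h \<le> real i + 1"
      using i by linarith+
    then have i1: "pt k i < \<tau>" "\<tau> \<le> pt k (Suc i)"
      using h by (auto simp: pt field_simps)
    have bpt: "b = pt k (Suc k)" by (simp add: pt_def)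
    have "real i * h < real (Suc k) * h" using i1 \<tau> bpt by (simp add: pt)
    then have ik: "i < Suc k" using h mult_less_cancel_right_pos[of h] of_nat_less_iff by blast
    have uniq_i: "\<tau> \<notin> {pt k j<..pt k (Suc j)}" if "j \<noteq> i" for j
    proof
      assume "\<tau> \<in> {pt k j<..pt k (Suc j)}"
      then have "real j * h < real (Suc i) * h" "real i * h < real (Suc j) * h"
        using i1 by (auto simp: pt)
      then have "j < Suc i" "i < Suc j" using h mult_less_cancel_right_pos[of h] of_nat_less_iff by blast+
      then show False using that by simp
    qed
    have "w k j \<bullet> (indicator {pt k j<..pt k (Suc j)} \<tau> *\<^sub>R v \<tau>) = (if j = i then w k i \<bullet> v \<tau> else 0)" for j
      using i1 uniq_i[of j] by (cases "j = i") simp_all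
    then have f: "f k \<tau> = w k i \<bullet> v \<tau>"
      unfolding f_def using ik by simp
    have "pt k (Suc i) = pt k i + h" by (simp add: pt algebra_simps)
    then have near: "pt k i \<in> cball \<tau> h" "pt k (Suc i) \<in> cball \<tau> h"
      using i1 by (auto simp: dist_real_def)
    show ?thesis
      unfolding h_def[symmetric] f w_def
      using near pt_in[of i k] pt_in[of "Suc i" k] ik
      by (intro exI[of _ "tag k i"] exI[of _ "pt k i"] exI[of _ "pt k (Suc i)"]) (auto simp: tag_def)
  qed
  have f0: "f k \<tau> = 0" if "\<tau> \<notin> {a<..b}" for k \<tau>
  proof -
    have "indicator {pt k i<..pt k (Suc i)} \<tau> = (0::real)" if "i < Suc k" for i
      using pt_in[of i k] pt_in[of "Suc i" k] that \<open>\<tau> \<notin> {a<..b}\<close> by (auto simp: indicator_def)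
    then show ?thesis by (simp add: f_def)
  qed
  \<comment> \<open>\<open>dist_grad\<close> has norm 1, which bounds \<open>log_dist_grad\<close>
    by \<open>inverse c\<close>; two points of the curve differ by at most
    \<open>2 * D\<close>.\<close>
  define B where "B = inverse c + inverse (2 * c\<^sup>2) * (2 * D)"
  have dom: "norm (f k \<tau>) \<le> norm (B *\<^sub>R (indicator {a..b} \<tau> *\<^sub>R v \<tau>))" for k \<tau>
  proof (cases "\<tau> \<in> {a<..b}")
    case True
    obtain p q r where pqr: "{p, q, r} \<subseteq> {a..b}" "f k \<tau> = (\<sigma> *\<^sub>R ?W p + (z r - z q) /\<^sub>R (2 * c\<^sup>2)) \<bullet> v \<tau>"
      using rep[OF True, of k] by blast
    have "norm (?W p) = inverse (?g p) * norm (dist_grad S (z p))"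
      by (simp add: log_dist_grad_def infdist_nonneg)
    also have "\<dots> \<le> inverse c"
      using norm_dist_grad[OF cl S(2) pos[of p]] c(1) c(2)[of p] pqr(1) by (simp add: le_imp_inverse_le)
    finally have W: "norm (\<sigma> *\<^sub>R ?W p) \<le> inverse c" using \<sigma> by auto
    have "norm (z r - z q) \<le> 2 * D" using D(2)[of r] D(2)[of q] pqr norm_triangle_ineq4[of "z r" "z q"] by simp
    then have "inverse (2 * c\<^sup>2) * norm (z r - z q) \<le> inverse (2 * c\<^sup>2) * (2 * D)"
      by (rule mult_left_mono) simp
    then have "norm ((z r - z q) /\<^sub>R (2 * c\<^sup>2)) \<le> inverse (2 * c\<^sup>2) * (2 * D)"
      by simp
    then have "norm (\<sigma> *\<^sub>R ?W p + (z r - z q) /\<^sub>R (2 * c\<^sup>2)) \<le> B"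
      unfolding B_def using W norm_triangle_mono by blast
    then have "norm (f k \<tau>) \<le> B * norm (v \<tau>)"
      unfolding pqr(2) using Cauchy_Schwarz_ineq2[of "\<sigma> *\<^sub>R ?W p + (z r - z q) /\<^sub>R (2 * c\<^sup>2)" "v \<tau>"]
      by (smt (verit) mult_right_mono norm_ge_zero real_norm_def)
    also have "\<dots> \<le> \<bar>B\<bar> * norm (v \<tau>)" by (intro mult_right_mono) auto
    finally show ?thesis using True by simp
  qed (simp add: f0)
  \<comment> \<open>This is where uniqueness of the nearest point enters: it makes
    \<open>dist_grad\<close> continuous at \<open>z \<tau>\<close>, so the sampled gradients
    converge, while the quadratic error vanishes by continuity of \<open>z\<close>.\<close>
  have lim: "AE \<tau> in lebesgue. (\<lambda>k. f k \<tau>) \<longlonglongrightarrow> indicator {a<..b} \<tau> * (\<sigma> * (?W \<tau> \<bullet> v \<tau>))"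
    using uniq
  proof eventually_elim
    case (elim \<tau>)
    show ?case
    proof (cases "\<tau> \<in> {a<..b}")
      case True
      then have \<tau>: "\<tau> \<in> {a..b}" by auto
      obtain p q r where pqr: "\<And>k. {p k, q k, r k} \<subseteq> {a..b} \<inter> cball \<tau> ((b - a) / real (Suc k))"
        "\<And>k. f k \<tau> = (\<sigma> *\<^sub>R ?W (p k) + (z (r k) - z (q k)) /\<^sub>R (2 * c\<^sup>2)) \<bullet> v \<tau>"
        using rep[OF True] by metis
      have conv: "(\<lambda>k. u (s k)) \<longlonglongrightarrow> u \<tau>"
        if "\<And>k. s k \<in> {a..b} \<inter> cball \<tau> ((b - a) / real (Suc k))" "continuous (at \<tau> within {a..b}) u"
        for s and u :: "real \<Rightarrow> 'a"
      proof -
        have "(\<lambda>k. (b - a) / real (Suc k)) \<longlonglongrightarrow> 0"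
          using LIMSEQ_inverse_real_of_nat[THEN tendsto_mult_right_zero, of "b - a"] by (simp add: divide_inverse)
        then have "(\<lambda>k. s k - \<tau>) \<longlonglongrightarrow> 0"
        proof (rule Lim_null_comparison[rotated])
          have "norm (s k - \<tau>) \<le> (b - a) / real (Suc k)" for k
            using that(1)[of k] by (simp add: dist_real_def abs_minus_commute)
          then show "\<forall>\<^sub>F k in sequentially. norm (s k - \<tau>) \<le> (b - a) / real (Suc k)"
            by (intro always_eventually allI)
        qed
        then have "s \<longlonglongrightarrow> \<tau>" by (simp add: LIM_zero_iff)
        then show ?thesis
          using that continuous_within_sequentially[of \<tau> "{a..b}" u] by (auto simp: o_def)
      qed
      have zc: "continuous (at \<tau> within {a..b}) z"
        using cont \<tau> by (simp add: continuous_on_eq_continuous_within)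
      have gc: "continuous (at \<tau> within {a..b}) (\<lambda>t. dist_grad S (z t))"
        by (rule continuous_within_compose3[OF isCont_dist_grad[OF S] zc]) (use elim \<tau> pos in auto)
      have "continuous (at \<tau> within {a..b}) ?W"
        unfolding log_dist_grad_def using pos[OF \<tau>] by (intro continuous_intros zc gc) auto
      then have "(\<lambda>k. ?W (p k)) \<longlonglongrightarrow> ?W \<tau>"
        using pqr(1) by (intro conv[of p ?W]) auto
      moreover have "(\<lambda>k. z (q k)) \<longlonglongrightarrow> z \<tau>" "(\<lambda>k. z (r k)) \<longlonglongrightarrow> z \<tau>"
        using pqr(1) zc conv[of q z] conv[of r z] by auto
      ultimately have "(\<lambda>k. f k \<tau>) \<longlonglongrightarrow> (\<sigma> *\<^sub>R ?W \<tau> + (z \<tau> - z \<tau>) /\<^sub>R (2 * c\<^sup>2)) \<bullet> v \<tau>"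
        unfolding pqr(2) by (intro tendsto_intros)
      then show ?thesis using True by simp
    qed (simp add: f0)
  qed
  \<comment> \<open>Taking the limit itself as integrand gives measurability at once, although
    \<open>log_dist_grad\<close> involves an arbitrary choice of nearest points.\<close>
  define F where "F \<tau> = Topological_Spaces.lim (\<lambda>k. f k \<tau>)" for \<tau>
  have F: "AE \<tau> in lebesgue. F \<tau> = indicator {a<..b} \<tau> * (\<sigma> * (?W \<tau> \<bullet> v \<tau>))"
    using lim by eventually_elim (auto simp: F_def intro: limI)
  have fm [measurable]: "f k \<in> borel_measurable lebesgue" for k
    using f_int by auto
  have Fm: "F \<in> borel_measurable lebesgue"
    unfolding F_def[abs_def] by measurable
  have "(\<lambda>k. LINT \<tau>|lebesgue. f k \<tau>) \<longlonglongrightarrow> (LINT \<tau>|lebesgue. F \<tau>)"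
  proof (rule integral_dominated_convergence[where w = "\<lambda>\<tau>. norm (B *\<^sub>R (indicator {a..b} \<tau> *\<^sub>R v \<tau>))"])
    show "AE \<tau> in lebesgue. (\<lambda>k. f k \<tau>) \<longlonglongrightarrow> F \<tau>"
      using lim F by eventually_elim simp
    show "integrable lebesgue (\<lambda>\<tau>. norm (B *\<^sub>R (indicator {a..b} \<tau> *\<^sub>R v \<tau>)))"
      using v unfolding set_integrable_def by (intro integrable_norm integrable_scaleR_right) auto
  qed (use Fm fm dom in auto)
  then have "\<sigma> * (ln (?g b) - ln (?g a)) \<le> (LINT \<tau>|lebesgue. F \<tau>)"
    by (rule LIMSEQ_le_const) (use below in auto)
  also have "\<dots> \<le> C"
  proof (rule integral_real_bounded[OF C(2)])
    have "AE \<tau> in lebesgue. ennreal (F \<tau>) \<le> indicator {a..b} \<tau> * m \<tau>"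
      using F m
    proof eventually_elim
      case (elim \<tau>)
      show ?case
      proof (cases "\<tau> \<in> {a<..b}")
        case True
        have "F \<tau> \<le> \<bar>?W \<tau> \<bullet> v \<tau>\<bar>" using elim True \<sigma> by auto
        then have "ennreal (F \<tau>) \<le> ennreal \<bar>?W \<tau> \<bullet> v \<tau>\<bar>" by (rule ennreal_leI)
        also have "\<dots> \<le> m \<tau>" using elim True by simp
        finally show ?thesis using True by simp
      qed (use elim in auto)
    qed
    then have "(\<integral>\<^sup>+\<tau>. ennreal (F \<tau>) \<partial>lebesgue) \<le> (\<integral>\<^sup>+\<tau>. indicator {a..b} \<tau> * m \<tau> \<partial>lebesgue)"
      by (rule nn_integral_mono_AE)
    then show "(\<integral>\<^sup>+\<tau>. ennreal (F \<tau>) \<partial>lebesgue) \<le> ennreal C" using C(1) by simp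
  qed
  finally show ?thesis .
qed

text \<open>The bound \<open>C\<close> is the same for every interval free of zeros. Starting from
  \<open>t0\<close>, the distance therefore cannot fall below \<open>exp (- C)\<close> times its
  initial value before its first zero, which contradicts continuity at that zero. Times before
  \<open>t0\<close> are treated in the same way with the last zero.\<close>

lemma infdist_pos_along_curve:
  fixes S :: "'a::euclidean_space set" and z v :: "real \<Rightarrow> 'a" and m :: "real \<Rightarrow> ennreal"
  assumes S: "compact S" "S \<noteq> {}"
    and v: "set_integrable lebesgue {0..T} v"
    and incr: "\<And>s t. 0 \<le> s \<Longrightarrow> s \<le> t \<Longrightarrow> t \<le> T \<Longrightarrow> z t - z s = (LINT \<tau>:{s<..t}|lebesgue. v \<tau>)"
    and cont: "continuous_on {0..T} z"
    and uniq: "AE \<tau> in lebesgue. \<tau> \<in> {0..T} \<longrightarrow> z \<tau> \<notin> multi_nearest S"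
    and m: "AE \<tau> in lebesgue. \<tau> \<in> {0..T} \<longrightarrow> infdist (z \<tau>) S > 0 \<longrightarrow>
      ennreal \<bar>log_dist_grad S (z \<tau>) \<bullet> v \<tau>\<bar> \<le> m \<tau>"
    and fin: "(\<integral>\<^sup>+\<tau>. indicator {0..T} \<tau> * m \<tau> \<partial>lebesgue) < top"
    and t0: "t0 \<in> {0..T}" "infdist (z t0) S > 0" and t1: "t1 \<in> {0..T}"
  shows "infdist (z t1) S > 0"
proof -
  let ?g = "\<lambda>t. infdist (z t) S"
  define C where "C = enn2real (\<integral>\<^sup>+\<tau>. indicator {0..T} \<tau> * m \<tau> \<partial>lebesgue)"
  have C: "0 \<le> C" "(\<integral>\<^sup>+\<tau>. indicator {0..T} \<tau> * m \<tau> \<partial>lebesgue) = ennreal C"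
    using fin by (auto simp: C_def)
  have gcont: "continuous_on {0..T} ?g"
    by (intro continuous_intros cont)
  have bound: "\<bar>ln (?g b) - ln (?g a)\<bar> \<le> C"
    if ab: "0 \<le> a" "a \<le> b" "b \<le> T" and pos: "\<And>t. t \<in> {a..b} \<Longrightarrow> ?g t > 0" for a b
  proof (cases "a = b")
    case False
    have sub: "{a..b} \<subseteq> {0..T}" using ab by auto
    have "(\<integral>\<^sup>+\<tau>. indicator {a..b} \<tau> * m \<tau> \<partial>lebesgue) \<le> (\<integral>\<^sup>+\<tau>. indicator {0..T} \<tau> * m \<tau> \<partial>lebesgue)"
      using sub by (intro nn_integral_mono mult_right_mono) (auto simp: indicator_def)
    then have Cab: "(\<integral>\<^sup>+\<tau>. indicator {a..b} \<tau> * m \<tau> \<partial>lebesgue) \<le> ennreal C"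
      using C by simp
    have vab: "set_integrable lebesgue {a..b} v"
      using sub by (intro set_integrable_subset[OF v]) auto
    have incr': "z t - z s = (LINT \<tau>:{s<..t}|lebesgue. v \<tau>)" if "a \<le> s" "s \<le> t" "t \<le> b" for s t
      using incr[of s t] that ab by simp
    have cont': "continuous_on {a..b} z" using cont sub by (rule continuous_on_subset)
    have uniq': "AE \<tau> in lebesgue. \<tau> \<in> {a..b} \<longrightarrow> z \<tau> \<notin> multi_nearest S"
      using uniq by eventually_elim (use sub in blast)
    have m': "AE \<tau> in lebesgue. \<tau> \<in> {a..b} \<longrightarrow> ennreal \<bar>log_dist_grad S (z \<tau>) \<bullet> v \<tau>\<bar> \<le> m \<tau>"
      using m by eventually_elim (use sub pos in blast)
    have "\<sigma> * (ln (?g b) - ln (?g a)) \<le> C" if "\<sigma> = 1 \<or> \<sigma> = - 1" for \<sigma>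
      using ab False by (intro ln_infdist_along_curve[OF S _ vab incr' cont' pos uniq' m' Cab C(1) that]) auto
    from this[of 1] this[of "- 1"] show ?thesis by simp
  qed (use C in simp)
  \<comment> \<open>Reaching this level means a drop of the logarithm by \<open>C + 1\<close>, one
    more than the bound allows.\<close>
  define \<delta> where "\<delta> = ?g t0 * exp (- C - 1)"
  have "\<delta> < ?g t0 * 1"
    unfolding \<delta>_def using t0(2) C(1) by (intro mult_strict_left_mono) auto
  then have \<delta>: "0 < \<delta>" "\<delta> < ?g t0" "ln (?g t0) - ln \<delta> = C + 1"
    using t0(2) by (simp_all add: \<delta>_def ln_mult)
  define Z where "Z I = {t\<in>I. ?g t = 0}" for I
  have Zc: "compact (Z {a..b})" if "{a..b} \<subseteq> {0..T}" for a b
  proof -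
    have "Z {a..b} = {a..b} \<inter> ?g -` {0}" by (auto simp: Z_def)
    moreover have "closed ({a..b} \<inter> ?g -` {0})"
      by (rule continuous_closed_preimage[OF continuous_on_subset[OF gcont that]]) simp_all
    ultimately show ?thesis
      using compact_Int_closed[of "{a..b}" "{a..b} \<inter> ?g -` {0}"] by simp
  qed
  show ?thesis
  proof (rule ccontr)
    assume "\<not> ?thesis"
    then have z1: "?g t1 = 0" using infdist_nonneg[of "z t1" S] by simp
    show False
    proof (cases "t0 \<le> t1")
      case True
      have sub: "{t0..t1} \<subseteq> {0..T}" using t0 t1 by auto
      have "t1 \<in> Z {t0..t1}" using z1 True by (simp add: Z_def)
      \<comment> \<open>The zero next to \<open>t0\<close>; up to any earlier time the curve is off
        \<open>S\<close> and \<open>bound\<close> applies.\<close>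
      then obtain t where t: "t \<in> Z {t0..t1}" "\<And>s. s \<in> Z {t0..t1} \<Longrightarrow> t \<le> s"
        using compact_attains_inf[OF Zc[OF sub]] by blast
      have tt: "t0 \<le> t" "t \<le> t1" "?g t = 0" using t(1) by (auto simp: Z_def)
      have "continuous_on {t0..t} ?g"
        using tt sub by (intro continuous_on_subset[OF gcont]) auto
      then obtain s where s: "t0 \<le> s" "s \<le> t" "?g s = \<delta>"
        using IVT2'[of ?g t \<delta> t0] \<delta> tt by auto
      have "?g r > 0" if "r \<in> {t0..s}" for r
      proof (rule ccontr)
        assume "\<not> ?g r > 0"
        then have "r \<in> Z {t0..t1}" using that s tt infdist_nonneg[of "z r" S] by (auto simp: Z_def)
        then have "t \<le> r" by (rule t(2))
        then have "s = t" using that s by simp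
        then show False using s tt \<delta> by simp
      qed
      then have "\<bar>ln (?g s) - ln (?g t0)\<bar> \<le> C"
        using s tt t0 t1 by (intro bound) auto
      then show False using \<delta>(3) s(3) by simp
    next
      case False
      have sub: "{t1..t0} \<subseteq> {0..T}" using t0 t1 by auto
      have "t1 \<in> Z {t1..t0}" using z1 False by (simp add: Z_def)
      then obtain t where t: "t \<in> Z {t1..t0}" "\<And>s. s \<in> Z {t1..t0} \<Longrightarrow> s \<le> t"
        using compact_attains_sup[OF Zc[OF sub]] by blast
      have tt: "t1 \<le> t" "t \<le> t0" "?g t = 0" using t(1) by (auto simp: Z_def)
      have "continuous_on {t..t0} ?g"
        using tt sub by (intro continuous_on_subset[OF gcont]) auto
      then obtain s where s: "t \<le> s" "s \<le> t0" "?g s = \<delta>"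
        using IVT'[of ?g t \<delta> t0] \<delta> tt by auto
      have "?g r > 0" if "r \<in> {s..t0}" for r
      proof (rule ccontr)
        assume "\<not> ?g r > 0"
        then have "r \<in> Z {t1..t0}" using that s tt infdist_nonneg[of "z r" S] by (auto simp: Z_def)
        then have "r \<le> t" by (rule t(2))
        then have "s = t" using that s by simp
        then show False using s tt \<delta> by simp
      qed
      then have "\<bar>ln (?g t0) - ln (?g s)\<bar> \<le> C"
        using s tt t0 t1 by (intro bound) auto
      then show False using \<delta>(3) s(3) by simp
    qed
  qed
qed

section \<open>Hoelder's inequality in mixed Lebesgue spaces\<close>

lemma ennreal_powr_measurable [measurable]: "(\<lambda>x. ennreal_powr x r) \<in> borel_measurable borel"
  unfolding ennreal_powr_def by measurable

lemma ennreal_powr_one [simp]: "ennreal_powr x 1 = x"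
  by (cases x) (auto simp: ennreal_powr_def)

lemma ennreal_powr_ennreal [simp]: "0 \<le> x \<Longrightarrow> ennreal_powr (ennreal x) r = ennreal (x powr r)"
  by (simp add: ennreal_powr_def)

lemma ennreal_powr_top [simp]: "ennreal_powr top r = top"
  by (simp add: ennreal_powr_def)

lemma ennreal_powr_eq_0_iff [simp]: "ennreal_powr x r = 0 \<longleftrightarrow> x = 0"
  by (cases x) auto

text \<open>In \<open>ennreal\<close> the equation covers the endpoint pairs through
  \<open>1 / top = 0\<close>, and it excludes \<open>p' = 0\<close>, whose reciprocal is infinite.
  Young's inequality is required only in the last case.\<close>

lemma dual_exponent_cases:
  assumes "1 \<le> p" "1 / p + 1 / p' = (1::ennreal)"
  obtains "p = 1" "p' = top" | "p = top" "p' = 1"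
    | P P' where "p = ennreal P" "p' = ennreal P'" "1 < P" "1 < P'" "1 / P + 1 / P' = 1"
proof -
  have inv: "1 / ennreal r = ennreal (1 / r)" if "0 < r" for r
    using divide_ennreal[of 1 r] that by simp
  have "p' \<noteq> 0"
    using assms(2) by (auto simp: divide_ennreal_def)
  then have p': "p' = top \<or> (\<exists>P'>0. p' = ennreal P')"
    by (cases p') (auto simp: less_le)
  show ?thesis
  proof (cases "p = top")
    case True
    then have one: "1 / p' = ennreal 1" using assms(2) by simp
    then obtain P' where P': "P' > 0" "p' = ennreal P'"
      using p' by auto
    then have "1 / P' = 1"
      using one inv[of P'] by (simp del: ennreal_1)
    then show ?thesis using P' True that(2) by simp
  next
    case False
    then obtain P where P: "p = ennreal P" "0 \<le> P" by (cases p) auto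
    with assms(1) have P1: "1 \<le> P" by simp
    then have pinv: "1 / p = ennreal (1 / P)"
      using P inv[of P] by simp
    show ?thesis
    proof (cases "p' = top")
      case True
      then have "ennreal (1 / P) = ennreal 1" using assms(2) pinv by simp
      then have "1 / P = 1" using P1 by (simp del: ennreal_1)
      then show ?thesis using True P that(1) by simp
    next
      case False
      then obtain P' where P': "P' > 0" "p' = ennreal P'" using p' by blast
      have "ennreal (1 / P + 1 / P') = ennreal 1"
        using assms(2) pinv P' inv[of P'] P1 by (simp del: ennreal_1 add: ennreal_plus)
      moreover have nn: "0 \<le> 1 / P + 1 / P'" using P1 P' by simp
      ultimately have e: "1 / P + 1 / P' = 1"
        using ennreal_inj[of "1 / P + 1 / P'" 1] by simp
      have "1 / P' > 0" "1 / P > 0" using P' P1 by auto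
      then have "1 / P < 1" "1 / P' < 1" using e by linarith+
      then have "1 < P" "1 < P'" using P1 P' by (simp_all add: divide_less_eq)
      then show ?thesis using e P P' that(3) by blast
    qed
  qed
qed

lemma nn_integral_mult_le_esssup:
  assumes [measurable]: "F \<in> borel_measurable M" "G \<in> borel_measurable M"
  shows "(\<integral>\<^sup>+x. F x * G x \<partial>M) \<le> (\<integral>\<^sup>+x. F x \<partial>M) * esssup M G"
proof -
  have "(\<integral>\<^sup>+x. F x * G x \<partial>M) \<le> (\<integral>\<^sup>+x. F x * esssup M G \<partial>M)"
    using esssup_AE[of G M] by (intro nn_integral_mono_AE) (auto elim!: eventually_mono intro: mult_left_mono)
  also have "\<dots> = (\<integral>\<^sup>+x. F x \<partial>M) * esssup M G"
    by (rule nn_integral_multc) measurable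
  finally show ?thesis .
qed

lemma Hoelder_ennreal:
  fixes P P' :: real
  assumes P: "1 < P" "1 < P'" "1 / P + 1 / P' = 1"
    and [measurable]: "F \<in> borel_measurable M" "G \<in> borel_measurable M"
  shows "(\<integral>\<^sup>+x. F x * G x \<partial>M)
    \<le> ennreal_powr (\<integral>\<^sup>+x. ennreal_powr (F x) P \<partial>M) (1 / P)
      * ennreal_powr (\<integral>\<^sup>+x. ennreal_powr (G x) P' \<partial>M) (1 / P')"
    (is "?I \<le> ennreal_powr ?A _ * ennreal_powr ?B _")
proof -
  consider "?A = 0 \<or> ?B = 0" | "?A \<noteq> 0" "?B \<noteq> 0" "?A = top \<or> ?B = top"
    | "?A \<noteq> 0" "?B \<noteq> 0" "?A < top" "?B < top"
    by (metis top.not_eq_extremum)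
  then show ?thesis
  proof cases
    case 1
    \<comment> \<open>One factor vanishes almost everywhere, and 0 times infinity is 0.\<close>
    then have "AE x in M. F x * G x = 0"
      by (auto simp: nn_integral_0_iff_AE elim: eventually_mono)
    then have "?I = 0" by (simp add: nn_integral_0_iff_AE)
    then show ?thesis by simp
  next
    case 2
    then show ?thesis by (auto simp: ennreal_mult_top ennreal_top_mult)
  next
    case 3
    obtain \<alpha> where \<alpha>: "?A = ennreal \<alpha>" "0 < \<alpha>"
      using 3 by (cases ?A) (auto simp: less_le)
    obtain \<beta> where \<beta>: "?B = ennreal \<beta>" "0 < \<beta>"
      using 3 by (cases ?B) (auto simp: less_le)
    define a where "a = \<alpha> powr (1 / P)"
    define b where "b = \<beta> powr (1 / P')"
    have ab: "0 < a" "0 < b" "a powr P = \<alpha>" "b powr P' = \<beta>"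
      using \<alpha> \<beta> P by (auto simp: a_def b_def powr_powr)
    \<comment> \<open>The coefficients of Young's inequality for \<open>F / a\<close> and
      \<open>G / b\<close> after multiplication by \<open>a * b\<close>. Integration turns them into
      \<open>a * b * (1 / P + 1 / P')\<close>.\<close>
    define c where "c = a * b / (P * \<alpha>)"
    define c' where "c' = a * b / (P' * \<beta>)"
    have c: "0 < c" "0 < c'" using ab \<alpha> \<beta> P by (auto simp: c_def c'_def)
    have young: "F x * G x \<le> ennreal c * ennreal_powr (F x) P + ennreal c' * ennreal_powr (G x) P'" for x
    proof (cases "F x = top \<or> G x = top")
      case True
      then show ?thesis using c by (auto simp: ennreal_mult_top)
    next
      case False
      then obtain f g where fg: "F x = ennreal f" "0 \<le> f" "G x = ennreal g" "0 \<le> g"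
        by (cases "F x"; cases "G x") auto
      have "(f / a) * (g / b) \<le> (f / a) powr P / P + (g / b) powr P' / P'"
        using fg ab P by (intro Youngs_inequality) auto
      also have "\<dots> = f powr P / (P * \<alpha>) + g powr P' / (P' * \<beta>)"
        using fg ab by (simp add: powr_divide mult.commute)
      finally have "(a * b) * ((f / a) * (g / b)) \<le> (a * b) * (f powr P / (P * \<alpha>) + g powr P' / (P' * \<beta>))"
        using ab by (intro mult_left_mono) auto
      then have "f * g \<le> c * f powr P + c' * g powr P'"
        using ab by (simp add: c_def c'_def distrib_left)
      then have "ennreal (f * g) \<le> ennreal (c * f powr P + c' * g powr P')" by (rule ennreal_leI)
      then show ?thesis using fg c by (simp add: ennreal_mult)
    qed
    have "?I \<le> (\<integral>\<^sup>+x. ennreal c * ennreal_powr (F x) P + ennreal c' * ennreal_powr (G x) P' \<partial>M)"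
      by (intro nn_integral_mono young)
    also have "\<dots> = ennreal c * ?A + ennreal c' * ?B"
      by (simp add: nn_integral_add nn_integral_cmult)
    also have "\<dots> = ennreal (c * \<alpha> + c' * \<beta>)"
      using \<alpha> \<beta> c by (simp add: ennreal_mult)
    also have "c * \<alpha> + c' * \<beta> = a * b * (1 / P + 1 / P')"
      using \<alpha> \<beta> by (simp add: c_def c'_def distrib_left)
    also have "ennreal \<dots> = ennreal a * ennreal b"
      unfolding P(3) using ab by (simp add: ennreal_mult)
    finally show ?thesis
      unfolding \<alpha>(1) \<beta>(1) a_def b_def
      by (simp only: ennreal_powr_ennreal less_imp_le[OF \<alpha>(2)] less_imp_le[OF \<beta>(2)])
  qed
qed

text \<open>Measurability is asked of the absolute values, which is the form in which it is
  available for almost every time section.\<close>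

lemma Hoelder_Lp_norm:
  assumes "1 \<le> p" "1 / p + 1 / p' = 1"
    and [measurable]: "(\<lambda>x. e2ennreal \<bar>f x\<bar>) \<in> borel_measurable M" "(\<lambda>x. e2ennreal \<bar>g x\<bar>) \<in> borel_measurable M"
  shows "(\<integral>\<^sup>+x. e2ennreal \<bar>f x\<bar> * e2ennreal \<bar>g x\<bar> \<partial>M) \<le> Lp_norm M p f * Lp_norm M p' g"
  using assms(1,2)
proof (cases rule: dual_exponent_cases)
  case 1
  then show ?thesis
    using nn_integral_mult_le_esssup[OF assms(3,4)] by (simp add: Lp_norm_def)
next
  case 2
  then show ?thesis
    using nn_integral_mult_le_esssup[OF assms(4,3)] by (simp add: Lp_norm_def mult.commute)
next
  case (3 P P')
  then show ?thesis
    using Hoelder_ennreal[OF 3(3-5) assms(3,4)] by (simp add: Lp_norm_def)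
qed

lemma Lp_norm_const_finite:
  assumes "finite_measure M" "0 < p" "e2ennreal \<bar>c\<bar> < top"
  shows "Lp_norm M p (\<lambda>_. c) < top"
proof (cases "p = top")
  case True
  then show ?thesis
    using assms(3) esssup_I[of "\<lambda>_. e2ennreal \<bar>c\<bar>" M "e2ennreal \<bar>c\<bar>"]
    by (auto simp: Lp_norm_def)
next
  case False
  interpret finite_measure M by fact
  obtain C where C: "e2ennreal \<bar>c\<bar> = ennreal C" "0 \<le> C" using assms(3) by (cases "e2ennreal \<bar>c\<bar>") auto
  have "(\<integral>\<^sup>+x. ennreal (C powr enn2real p) \<partial>M) = ennreal (C powr enn2real p * measure M (space M))"
    by (simp add: emeasure_eq_measure ennreal_mult)
  then show ?thesis using False C by (simp add: Lp_norm_def)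
qed

section \<open>Sections of Lebesgue measurable functions on a product\<close>

lemma (in complete_measure) measurable_AE_cong:
  assumes "AE x in M. f x = g x" "f \<in> measurable M N" "g \<in> space M \<rightarrow> space N"
  shows "g \<in> measurable M N"
proof (rule measurableI)
  show "g x \<in> space N" if "x \<in> space M" for x using assms(3) that by auto
  show "g -` A \<inter> space M \<in> sets M" if "A \<in> sets N" for A
  proof (rule in_sets_AE)
    show "AE x in M. (x \<in> f -` A \<inter> space M) = (x \<in> g -` A \<inter> space M)"
      using assms(1) by eventually_elim auto
    show "f -` A \<inter> space M \<in> sets M" using assms(2) that by (rule measurable_sets)
  qed auto
qed

lemma AE_lebesgue_on:
  assumes "A \<in> sets lebesgue"
  shows "(AE t in lebesgue_on A. P t) \<longleftrightarrow> (AE t in lborel. t \<in> A \<longrightarrow> P t)"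
  using assms by (subst AE_restrict_space_iff) (auto simp: AE_completion_iff)

lemma nn_integral_lebesgue_on:
  assumes "A \<in> sets lebesgue"
  shows "(\<integral>\<^sup>+t. f t \<partial>lebesgue_on A) = (\<integral>\<^sup>+t. indicator A t * f t \<partial>lborel)"
  using assms by (subst nn_integral_restrict_space) (auto simp: nn_integral_completion mult.commute)

text \<open>Lebesgue measure on the product is the completion of the product measure, so single
  sections may fail to be measurable. A Borel version has Borel sections only, by Fubini almost
  every section of \<open>F\<close> agrees with it almost everywhere, and completeness transfers the
  measurability.\<close>

lemma AE_section_measurable:
  fixes F :: "real \<times> 'a::euclidean_space \<Rightarrow> ennreal"
  assumes F: "F \<in> borel_measurable lebesgue"
  shows "AE t in lborel. (\<lambda>y. F (t, y)) \<in> borel_measurable lebesgue"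
proof -
  obtain F0 where F0: "F0 \<in> borel_measurable lborel" "AE z in lborel. F z = F0 z"
    using completion_ex_borel_measurable[OF F] by blast
  have "AE z in lborel \<Otimes>\<^sub>M lborel. F z = F0 z"
    unfolding lborel_prod by (rule F0)
  then have "AE t in lborel. AE y in lborel. F (t, y) = F0 (t, y)"
    by (rule lborel_pair.AE_pair)
  then show ?thesis
  proof eventually_elim
    case (elim t)
    have "(\<lambda>y. (t, y)) \<in> borel_measurable (lborel :: 'a measure)"
      by (simp add: borel_measurable_continuous_onI continuous_on_Pair)
    then have "(\<lambda>y. F0 (t, y)) \<in> borel_measurable lborel"
      by (rule measurable_compose) (use F0(1) in simp)
    then have "(\<lambda>y. F0 (t, y)) \<in> borel_measurable lebesgue"
      by (rule measurable_completion)
    moreover have "AE y in lborel. F0 (t, y) = F (t, y)"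
      using elim by eventually_elim simp
    then have "AE y in lebesgue. F0 (t, y) = F (t, y)"
      by (rule AE_completion)
    ultimately show ?case
      by (intro completion.measurable_AE_cong[of "\<lambda>y. F0 (t, y)" "\<lambda>y. F (t, y)"]) simp_all
  qed
qed

lemma measurable_indicator_extend:
  fixes F :: "'a::euclidean_space \<Rightarrow> ennreal"
  assumes "A \<in> sets lebesgue" "F \<in> borel_measurable (lebesgue_on A)"
  shows "(\<lambda>z. indicator A z * F z) \<in> borel_measurable lebesgue"
proof -
  have "(\<lambda>z. if z \<in> A then F z else 0) \<in> borel_measurable lebesgue"
    using assms measurable_restrict_space_iff[of A lebesgue 0 borel F] by simp
  moreover have "(\<lambda>z. if z \<in> A then F z else 0) = (\<lambda>z. indicator A z * F z)"
    by (auto simp: indicator_def)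
  ultimately show ?thesis by simp
qed

lemma open_strip_lebesgue: "{0<..<T} \<times> UNIV \<in> sets (lebesgue :: (real \<times> 'a::euclidean_space) measure)"
  by (simp add: borel_open open_Times)

text \<open>Hoelder's inequality twice: in space over \<open>K\<close> with exponents
  \<open>q\<close> and \<open>q'\<close> for almost every time, then in time with \<open>p\<close>
  and \<open>p'\<close>.\<close>

lemma in_Lp_Lq_loc_mult_finite:
  fixes f g :: "real \<Rightarrow> 'a::euclidean_space \<Rightarrow> ereal"
  assumes p: "1 \<le> p" "1 / p + 1 / p' = 1" and q: "1 \<le> q" "1 / q + 1 / q' = 1"
    and f: "in_Lp_Lq_loc T p q f" and g: "in_Lp_Lq_loc T p' q' g" and K: "compact K"
  shows "(\<integral>\<^sup>+t. indicator {0<..<T} t *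
      (\<integral>\<^sup>+y. indicator K y * (e2ennreal \<bar>f t y\<bar> * e2ennreal \<bar>g t y\<bar>) \<partial>lborel) \<partial>lborel) < top"
proof -
  have Km: "K \<in> sets lebesgue" using K by (simp add: borel_compact)
  have sec: "AE t in lebesgue_on {0<..<T}. (\<lambda>y. e2ennreal \<bar>h t y\<bar>) \<in> borel_measurable (lebesgue_on K)"
    if h: "(\<lambda>(t, x). h t x) \<in> borel_measurable (lebesgue_on ({0<..<T} \<times> UNIV))" for h :: "real \<Rightarrow> 'a \<Rightarrow> ereal"
  proof -
    have "(\<lambda>z. e2ennreal \<bar>case_prod h z\<bar>) \<in> borel_measurable (lebesgue_on ({0<..<T} \<times> UNIV))"
      using h by measurable
    from AE_section_measurable[OF measurable_indicator_extend[OF open_strip_lebesgue this]]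
    have "AE t in lborel. t \<in> {0<..<T} \<longrightarrow> (\<lambda>y. e2ennreal \<bar>h t y\<bar>) \<in> borel_measurable (lebesgue_on K)"
    proof eventually_elim
      case (elim t)
      show ?case
      proof
        assume "t \<in> {0<..<T}"
        with elim have "(\<lambda>y. e2ennreal \<bar>h t y\<bar>) \<in> borel_measurable lebesgue" by simp
        then show "(\<lambda>y. e2ennreal \<bar>h t y\<bar>) \<in> borel_measurable (lebesgue_on K)"
          by (rule measurable_restrict_space1)
      qed
    qed
    then show ?thesis by (simp add: AE_lebesgue_on)
  qed
  have eabs: "(\<lambda>x. e2ennreal \<bar>h x\<bar>) \<in> borel_measurable M"
    if "h \<in> borel_measurable M" for h :: "real \<Rightarrow> ereal" and M
    using that by measurable
  have fm: "(\<lambda>(t, x). f t x) \<in> borel_measurable (lebesgue_on ({0<..<T} \<times> UNIV))"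
    and gm: "(\<lambda>(t, x). g t x) \<in> borel_measurable (lebesgue_on ({0<..<T} \<times> UNIV))"
    using f g by (auto simp: in_Lp_Lq_loc_def)
  let ?n = "\<lambda>t. Lp_norm (lebesgue_on K) q (f t)" and ?m = "\<lambda>t. Lp_norm (lebesgue_on K) q' (g t)"
  have fL: "in_Lp (lebesgue_on {0<..<T}) p (\<lambda>t. enn2ereal (?n t))"
    and gL: "in_Lp (lebesgue_on {0<..<T}) p' (\<lambda>t. enn2ereal (?m t))"
    using f g K by (auto simp: in_Lp_Lq_loc_def)
  have "(\<integral>\<^sup>+t. indicator {0<..<T} t *
      (\<integral>\<^sup>+y. indicator K y * (e2ennreal \<bar>f t y\<bar> * e2ennreal \<bar>g t y\<bar>) \<partial>lborel) \<partial>lborel)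
    = (\<integral>\<^sup>+t. \<integral>\<^sup>+y. e2ennreal \<bar>f t y\<bar> * e2ennreal \<bar>g t y\<bar> \<partial>lebesgue_on K \<partial>lebesgue_on {0<..<T})"
    by (simp add: nn_integral_lebesgue_on Km)
  also have "\<dots> \<le> (\<integral>\<^sup>+t. ?n t * ?m t \<partial>lebesgue_on {0<..<T})"
  proof (rule nn_integral_mono_AE)
    show "AE t in lebesgue_on {0<..<T}. (\<integral>\<^sup>+y. e2ennreal \<bar>f t y\<bar> * e2ennreal \<bar>g t y\<bar> \<partial>lebesgue_on K) \<le> ?n t * ?m t"
      using sec[OF fm] sec[OF gm] by eventually_elim (rule Hoelder_Lp_norm[OF q])
  qed
  also have "\<dots> = (\<integral>\<^sup>+t. e2ennreal \<bar>enn2ereal (?n t)\<bar> * e2ennreal \<bar>enn2ereal (?m t)\<bar> \<partial>lebesgue_on {0<..<T})"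
    by simp
  also have "\<dots> \<le> Lp_norm (lebesgue_on {0<..<T}) p (\<lambda>t. enn2ereal (?n t))
      * Lp_norm (lebesgue_on {0<..<T}) p' (\<lambda>t. enn2ereal (?m t))"
    using fL gL unfolding in_Lp_def by (intro Hoelder_Lp_norm[OF p] eabs) auto
  also have "\<dots> < top"
    using fL gL by (auto simp: in_Lp_def ennreal_mult_less_top)
  finally show ?thesis .
qed

text \<open>Paired with the inverse distance, the constant 1 yields the local integrability of the
  inverse distance itself, which handles the time component of the gradient.\<close>

lemma in_Lp_Lq_loc_one:
  assumes "0 < p" "0 < q"
  shows "in_Lp_Lq_loc T p q (\<lambda>t (x::'a::euclidean_space). 1)"
proof -
  have fin: "finite_measure (lebesgue_on A)" if "bounded A" "A \<in> sets lebesgue" for A :: "'b::euclidean_space set"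
    using bounded_set_imp_lmeasurable[OF that] by (rule finite_measure_lebesgue_on)
  have one: "e2ennreal \<bar>1\<bar> < top" by (simp add: one_ereal_def)
  have "Lp_norm (lebesgue_on {0<..<T}) p (\<lambda>t. enn2ereal (Lp_norm (lebesgue_on K) q (\<lambda>x. 1))) < top"
    if "compact K" for K :: "'a set"
  proof (intro Lp_norm_const_finite fin assms)
    have "Lp_norm (lebesgue_on K) q (\<lambda>x. 1) < top"
      using that by (intro Lp_norm_const_finite fin assms one) (auto simp: compact_imp_bounded borel_compact)
    then show "e2ennreal \<bar>enn2ereal (Lp_norm (lebesgue_on K) q (\<lambda>x. 1))\<bar> < top" by simp
  qed auto
  then show ?thesis by (auto simp: in_Lp_Lq_loc_def in_Lp_def)
qed

section \<open>Compressible flows\<close>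

lemma sigma_finite_completion:
  assumes "sigma_finite_measure M"
  shows "sigma_finite_measure (completion M)"
proof -
  obtain A where "countable A" "A \<subseteq> sets M" "\<Union>A = space M" "\<forall>a\<in>A. emeasure M a \<noteq> \<infinity>"
    using sigma_finite_measure.sigma_finite_countable[OF assms] by blast
  then show ?thesis
    by (intro sigma_finite_measure.intro exI[of _ A]) (auto simp: subset_eq)
qed

text \<open>Tonelli's theorem requires joint measurability, whereas each \<open>X t\<close> is
  measurable separately. Since almost every trajectory is continuous, sampling at ever finer time
  grids converges to the flow, and each sampled map is jointly measurable.\<close>

lemma flow_jointly_measurable_version:
  fixes X :: "real \<Rightarrow> 'a::euclidean_space \<Rightarrow> 'a"
  assumes T: "T > 0"
    and cont: "AE x in lebesgue. continuous_on {0..T} (\<lambda>t. X t x)"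
    and X: "\<And>t. t \<in> {0..T} \<Longrightarrow> X t \<in> borel_measurable lebesgue"
  obtains Y where "Y \<in> borel_measurable (lborel \<Otimes>\<^sub>M lebesgue)"
    "AE x in lebesgue. \<forall>t\<in>{0..T}. Y (t, x) = X t x"
proof -
  obtain N where N: "{x. \<not> continuous_on {0..T} (\<lambda>t. X t x)} \<subseteq> N" "N \<in> null_sets lebesgue"
    using cont unfolding eventually_ae_filter by auto
  have [measurable]: "N \<in> sets lebesgue" using N by auto
  \<comment> \<open>\<open>h k (g k t)\<close> is the last grid time not after \<open>t\<close>. As
    \<open>g k\<close> has integer values, composition with it is a countable case
    distinction.\<close>
  define g where "g k t = \<lfloor>real (Suc k) * t / T\<rfloor>" for k t
  define h where "h k i = real_of_int i * T / real (Suc k)" for k i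
  \<comment> \<open>The integer index ranges beyond the grid of the time interval, where nothing is
    known of \<open>X\<close>; the value 0 keeps \<open>Z\<close> measurable there.\<close>
  define Z where "Z k i x = (if h k i \<in> {0..T} then X (h k i) x else 0)" for k i x
  define Y where "Y = (\<lambda>(t, x). if t \<in> {0..T} \<and> x \<notin> N then X t x else 0)"
  define Yk where "Yk k = (\<lambda>(t, x). if t \<in> {0..T} \<and> x \<notin> N then Z k (g k t) x else 0)" for k
  have Zm: "Z k i \<in> borel_measurable lebesgue" for k i
    unfolding Z_def using X[of "h k i"] by (cases "h k i \<in> {0..T}") auto
  have gm: "g k \<in> lborel \<rightarrow>\<^sub>M count_space UNIV" for k
    unfolding g_def by measurable
  have ZZ: "(\<lambda>p. Z k (g k (fst p)) (snd p)) \<in> borel_measurable (lborel \<Otimes>\<^sub>M lebesgue)" for k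
    by (rule measurable_compose_countable[where f = "\<lambda>i p. Z k i (snd p)" and g = "\<lambda>p. g k (fst p)"])
      (use measurable_compose[OF measurable_snd Zm] measurable_compose[OF measurable_fst gm] in auto)
  have Ykm: "Yk k \<in> borel_measurable (lborel \<Otimes>\<^sub>M lebesgue)" for k
  proof -
    have "(\<lambda>p. if fst p \<in> {0..T} \<and> snd p \<notin> N then Z k (g k (fst p)) (snd p) else 0)
        \<in> borel_measurable (lborel \<Otimes>\<^sub>M lebesgue)"
      by (intro measurable_If ZZ) measurable
    then show ?thesis by (simp add: Yk_def case_prod_beta')
  qed
  have lim: "(\<lambda>k. Yk k p) \<longlonglongrightarrow> Y p" for p
  proof (cases "fst p \<in> {0..T} \<and> snd p \<notin> N")
    case True
    define t x where "t = fst p" and "x = snd p"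
    have tx: "t \<in> {0..T}" "x \<notin> N" and p: "p = (t, x)" using True by (auto simp: t_def x_def)
    have near: "h k (g k t) \<le> t" "t - T / real (Suc k) \<le> h k (g k t)" "0 \<le> h k (g k t)" for k
    proof -
      define u where "u = real (Suc k) * t / T"
      have eq: "t = u * T / real (Suc k)" using T by (simp add: u_def)
      have "0 \<le> u" using tx T by (simp add: u_def)
      have gu: "g k t = \<lfloor>u\<rfloor>" by (simp add: g_def u_def)
      have "of_int (g k t) \<le> u" unfolding gu by (rule of_int_floor_le)
      moreover have "u - 1 \<le> of_int (g k t)" unfolding gu by linarith
      moreover have "0 \<le> real_of_int (g k t)" unfolding gu using \<open>0 \<le> u\<close> by simp
      ultimately have "real_of_int (g k t) * T / real (Suc k) \<le> u * T / real (Suc k)"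
        "(u - 1) * T / real (Suc k) \<le> real_of_int (g k t) * T / real (Suc k)"
        "0 \<le> real_of_int (g k t) * T / real (Suc k)"
        using T by (auto intro!: divide_right_mono mult_right_mono mult_nonneg_nonneg)
      moreover have "(u - 1) * T / real (Suc k) = t - T / real (Suc k)"
        by (simp only: eq left_diff_distrib diff_divide_distrib mult_1)
      ultimately show "h k (g k t) \<le> t" "t - T / real (Suc k) \<le> h k (g k t)" "0 \<le> h k (g k t)"
        unfolding h_def eq[symmetric] by simp_all
    qed
    have inT: "h k (g k t) \<in> {0..T}" for k using near[of k] tx by auto
    have "(\<lambda>k. h k (g k t)) \<longlonglongrightarrow> t"
    proof (rule tendsto_sandwich)
      have "(\<lambda>k. t - T * inverse (real (Suc k))) \<longlonglongrightarrow> t - T * 0"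
        by (intro tendsto_intros LIMSEQ_inverse_real_of_nat)
      then show "(\<lambda>k. t - T / real (Suc k)) \<longlonglongrightarrow> t" by (simp add: divide_inverse)
      show "(\<lambda>k. t) \<longlonglongrightarrow> t" by simp
    qed (use near in auto)
    moreover have "continuous_on {0..T} (\<lambda>t. X t x)"
      using N(1) tx(2) by blast
    then have "continuous (at t within {0..T}) (\<lambda>t. X t x)"
      using tx(1) by (simp add: continuous_on_eq_continuous_within)
    ultimately have "(\<lambda>k. X (h k (g k t)) x) \<longlonglongrightarrow> X t x"
      using inT unfolding continuous_within_sequentially by (auto simp: o_def)
    then show ?thesis using inT tx unfolding Yk_def Y_def Z_def p by simp
  next
    case False
    then have "Yk k p = 0" "Y p = 0" for k by (auto simp: Yk_def Y_def case_prod_beta)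
    then show ?thesis by simp
  qed
  have "Y \<in> borel_measurable (lborel \<Otimes>\<^sub>M lebesgue)"
    by (rule borel_measurable_LIMSEQ_metric[OF Ykm]) (rule lim)
  moreover have "AE x in lebesgue. \<forall>t\<in>{0..T}. Y (t, x) = X t x"
    using AE_not_in[OF N(2)] by eventually_elim (auto simp: Y_def)
  ultimately show thesis by (rule that)
qed

text \<open>Compressibility says that the image of Lebesgue measure under \<open>X\<close> is at
  most \<open>L\<close> times Lebesgue measure on Borel sets; integration is monotone in the
  measure.\<close>

lemma nn_integral_compressible_le:
  assumes X: "X \<in> borel_measurable lebesgue"
    and L: "\<And>B. B \<in> sets borel \<Longrightarrow> emeasure lebesgue (X -` B) \<le> L * emeasure lborel B"
    and G: "G \<in> borel_measurable borel"
  shows "(\<integral>\<^sup>+x. G (X x) \<partial>lebesgue) \<le> L * (\<integral>\<^sup>+y. G y \<partial>lborel)"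
proof -
  have "(\<integral>\<^sup>+x. G (X x) \<partial>lebesgue) = (\<integral>\<^sup>+y. G y \<partial>distr lebesgue borel X)"
    using X G by (simp add: nn_integral_distr)
  also have "\<dots> \<le> (\<integral>\<^sup>+y. G y \<partial>scale_measure L lborel)"
  proof (rule nn_integral_mono_measure)
    show "distr lebesgue borel X \<le> scale_measure L lborel"
      using X L by (subst le_measure) (auto simp: emeasure_distr)
  qed simp
  also have "\<dots> = L * (\<integral>\<^sup>+y. G y \<partial>lborel)"
    using G by (subst nn_integral_scale_measure) simp_all
  finally show ?thesis .
qed

lemma flow_integrand_measurable:
  fixes Y :: "real \<times> 'a::euclidean_space \<Rightarrow> 'a" and G :: "real \<times> 'a \<Rightarrow> ennreal"
  assumes Y: "Y \<in> borel_measurable (lborel \<Otimes>\<^sub>M lebesgue)" and G: "G \<in> borel_measurable borel"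
  shows "(\<lambda>p. indicator {0..T} (fst p) * G (fst p, Y p)) \<in> borel_measurable (lborel \<Otimes>\<^sub>M lebesgue)"
proof -
  have "(\<lambda>p. (fst p, Y p)) \<in> (lborel \<Otimes>\<^sub>M lebesgue) \<rightarrow>\<^sub>M (borel \<Otimes>\<^sub>M borel)"
    by (intro measurable_Pair Y) simp
  then have "(\<lambda>p. (fst p, Y p)) \<in> (lborel \<Otimes>\<^sub>M lebesgue) \<rightarrow>\<^sub>M borel"
    by (simp add: borel_prod)
  note [measurable] = measurable_compose[OF this G]
  show ?thesis by measurable
qed

lemma flow_section_measurable:
  fixes Y :: "real \<times> 'a::euclidean_space \<Rightarrow> 'a" and G :: "real \<times> 'a \<Rightarrow> ennreal"
  assumes "Y \<in> borel_measurable (lborel \<Otimes>\<^sub>M lebesgue)" "G \<in> borel_measurable borel"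
  shows "(\<lambda>t. indicator {0..T} t * G (t, Y (t, x))) \<in> borel_measurable lborel"
proof -
  have "(\<lambda>t. (t, x)) \<in> lborel \<rightarrow>\<^sub>M (lborel \<Otimes>\<^sub>M lebesgue)"
    by (intro measurable_Pair) simp_all
  from measurable_compose[OF this flow_integrand_measurable[OF assms]] show ?thesis by simp
qed

lemma flow_time_integral_measurable:
  fixes Y :: "real \<times> 'a::euclidean_space \<Rightarrow> 'a" and G :: "real \<times> 'a \<Rightarrow> ennreal"
  assumes "Y \<in> borel_measurable (lborel \<Otimes>\<^sub>M lebesgue)" "G \<in> borel_measurable borel"
  shows "(\<lambda>x. \<integral>\<^sup>+t. indicator {0..T} t * G (t, Y (t, x)) \<partial>lborel) \<in> borel_measurable lebesgue"
  using measurable_pair_swap[OF flow_integrand_measurable[OF assms]]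
  by (intro lborel.borel_measurable_nn_integral) simp

text \<open>After Tonelli has put time outside, compressibility applies at each fixed time, and the
  constant \<open>L\<close> is common to all times. \<open>Y\<close> replaces \<open>X\<close>
  because only \<open>Y\<close> is jointly measurable.\<close>

lemma flow_nn_integral_le:
  fixes X :: "real \<Rightarrow> 'a::euclidean_space \<Rightarrow> 'a"
  assumes X: "\<And>t. t \<in> {0..T} \<Longrightarrow> X t \<in> borel_measurable lebesgue"
    and L: "\<And>B t. B \<in> sets borel \<Longrightarrow> t \<in> {0..T} \<Longrightarrow> emeasure lebesgue (X t -` B) \<le> L * emeasure lborel B"
    and Y: "Y \<in> borel_measurable (lborel \<Otimes>\<^sub>M lebesgue)" "AE x in lebesgue. \<forall>t\<in>{0..T}. Y (t, x) = X t x"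
    and G [measurable]: "G \<in> borel_measurable borel"
  shows "(\<integral>\<^sup>+x. \<integral>\<^sup>+t. indicator {0..T} t * G (t, Y (t, x)) \<partial>lborel \<partial>lebesgue)
    \<le> L * (\<integral>\<^sup>+z. G z \<partial>lborel)"
proof -
  interpret lebesgue: sigma_finite_measure "lebesgue :: 'a measure"
    by (rule sigma_finite_completion[OF sigma_finite_lborel])
  interpret P: pair_sigma_finite "lborel :: real measure" "lebesgue :: 'a measure" ..
  have Gt: "(\<lambda>y. G (t, y)) \<in> borel_measurable borel" for t
    by (rule measurable_compose[OF _ G]) (simp add: borel_measurable_continuous_onI continuous_on_Pair)
  have "(\<integral>\<^sup>+x. \<integral>\<^sup>+t. indicator {0..T} t * G (t, Y (t, x)) \<partial>lborel \<partial>lebesgue)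
      = (\<integral>\<^sup>+t. \<integral>\<^sup>+x. indicator {0..T} t * G (t, Y (t, x)) \<partial>lebesgue \<partial>lborel)"
    using P.Fubini'[of "\<lambda>t x. indicator {0..T} t * G (t, Y (t, x))"] flow_integrand_measurable[OF Y(1) G]
    by (simp add: case_prod_beta')
  also have "\<dots> \<le> (\<integral>\<^sup>+t. L * (\<integral>\<^sup>+y. G (t, y) \<partial>lborel) \<partial>lborel)"
  proof (rule nn_integral_mono)
    fix t :: real
    show "(\<integral>\<^sup>+x. indicator {0..T} t * G (t, Y (t, x)) \<partial>lebesgue) \<le> L * (\<integral>\<^sup>+y. G (t, y) \<partial>lborel)"
    proof (cases "t \<in> {0..T}")
      case True
      have "(\<integral>\<^sup>+x. indicator {0..T} t * G (t, Y (t, x)) \<partial>lebesgue) = (\<integral>\<^sup>+x. G (t, X t x) \<partial>lebesgue)"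
        by (rule nn_integral_cong_AE) (use Y(2) True in \<open>auto elim!: eventually_mono\<close>)
      also have "\<dots> \<le> L * (\<integral>\<^sup>+y. G (t, y) \<partial>lborel)"
        using X[OF True] L[OF _ True] Gt by (rule nn_integral_compressible_le)
      finally show ?thesis .
    qed simp
  qed
  also have "\<dots> = L * (\<integral>\<^sup>+t. \<integral>\<^sup>+y. G (t, y) \<partial>lborel \<partial>lborel)"
    by (rule nn_integral_cmult) measurable
  also have "(\<integral>\<^sup>+t. \<integral>\<^sup>+y. G (t, y) \<partial>lborel \<partial>lborel) = (\<integral>\<^sup>+z. G z \<partial>(lborel \<Otimes>\<^sub>M lborel))"
    by (rule lborel.nn_integral_fst) (simp add: lborel_prod)
  finally show ?thesis by (simp add: lborel_prod)
qed

lemma flow_AE_nn_integral_finite: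
  fixes X :: "real \<Rightarrow> 'a::euclidean_space \<Rightarrow> 'a"
  assumes X: "\<And>t. t \<in> {0..T} \<Longrightarrow> X t \<in> borel_measurable lebesgue"
    and L: "\<And>B t. B \<in> sets borel \<Longrightarrow> t \<in> {0..T} \<Longrightarrow> emeasure lebesgue (X t -` B) \<le> L * emeasure lborel B"
    and Y: "Y \<in> borel_measurable (lborel \<Otimes>\<^sub>M lebesgue)" "AE x in lebesgue. \<forall>t\<in>{0..T}. Y (t, x) = X t x"
    and G: "G \<in> borel_measurable borel"
    and fin: "L < top" "(\<integral>\<^sup>+z. G z \<partial>lborel) < top"
  shows "AE x in lebesgue. (\<integral>\<^sup>+t. indicator {0..T} t * G (t, Y (t, x)) \<partial>lborel) < top"
proof -
  have "(\<integral>\<^sup>+x. \<integral>\<^sup>+t. indicator {0..T} t * G (t, Y (t, x)) \<partial>lborel \<partial>lebesgue) < top"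
    using flow_nn_integral_le[OF X L Y G] fin
    by (meson ennreal_mult_less_top le_less_trans)
  then show ?thesis
    using nn_integral_PInf_AE[OF flow_time_integral_measurable[OF Y(1) G]]
    by (simp add: less_top)
qed

text \<open>The time spent in \<open>N\<close>, integrated over all starting points, is at most
  \<open>L\<close> times the measure of \<open>N\<close>. This is how statements valid almost
  everywhere in space-time are carried to trajectories.\<close>

lemma flow_AE_avoids_null_set:
  fixes X :: "real \<Rightarrow> 'a::euclidean_space \<Rightarrow> 'a"
  assumes X: "\<And>t. t \<in> {0..T} \<Longrightarrow> X t \<in> borel_measurable lebesgue"
    and L: "\<And>B t. B \<in> sets borel \<Longrightarrow> t \<in> {0..T} \<Longrightarrow> emeasure lebesgue (X t -` B) \<le> L * emeasure lborel B"
    and Y: "Y \<in> borel_measurable (lborel \<Otimes>\<^sub>M lebesgue)" "AE x in lebesgue. \<forall>t\<in>{0..T}. Y (t, x) = X t x"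
    and N: "N \<in> null_sets lborel"
  shows "AE x in lebesgue. AE t in lborel. t \<in> {0..T} \<longrightarrow> (t, X t x) \<notin> N"
proof -
  let ?I = "\<lambda>x. \<integral>\<^sup>+t. indicator {0..T} t * indicator N (t, Y (t, x)) \<partial>lborel"
  have Nb: "N \<in> sets borel" using N by auto
  then have G: "(indicator N :: _ \<Rightarrow> ennreal) \<in> borel_measurable borel" by simp
  have "(\<integral>\<^sup>+x. ?I x \<partial>lebesgue) \<le> L * (\<integral>\<^sup>+z. indicator N z \<partial>lborel)"
    by (rule flow_nn_integral_le[OF X L Y G])
  also have "\<dots> = 0" using N Nb by (simp add: null_setsD1)
  finally have "AE x in lebesgue. ?I x = 0"
    using nn_integral_0_iff_AE[OF flow_time_integral_measurable[OF Y(1) G]] by simp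
  then show ?thesis
    using Y(2)
  proof eventually_elim
    case (elim x)
    have "(\<lambda>t. indicator {0..T} t * (indicator N (t, Y (t, x)) :: ennreal)) \<in> borel_measurable lborel"
      by (rule flow_section_measurable[OF Y(1) G])
    then have "AE t in lborel. indicator {0..T} t * (indicator N (t, Y (t, x)) :: ennreal) = 0"
      using elim(1) nn_integral_0_iff_AE by blast
    then show ?case
      by eventually_elim (use elim(2) in \<open>auto simp: indicator_def split: if_splits\<close>)
  qed
qed

section \<open>Avoidance\<close>

lemma absolutely_continuous_imp_continuous_on:
  fixes f :: "real \<Rightarrow> 'a::real_normed_vector"
  assumes "absolutely_continuous_on {a..b} f"
  shows "continuous_on {a..b} f"
  unfolding continuous_on_iff
proof (intro ballI allI impI)
  fix x e assume x: "x \<in> {a..b}" and e: "(0::real) < e"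
  have "\<exists>d>0. \<forall>D U. D division_of U \<and> U \<subseteq> {a..b} \<and> (\<Sum>I\<in>D. Sup I - Inf I) < d
      \<longrightarrow> (\<Sum>I\<in>D. norm (f (Sup I) - f (Inf I))) < e"
    using assms e unfolding absolutely_continuous_on_def by simp
  then obtain d where d: "d > 0" "\<forall>D U. D division_of U \<and> U \<subseteq> {a..b} \<and> (\<Sum>I\<in>D. Sup I - Inf I) < d
      \<longrightarrow> (\<Sum>I\<in>D. norm (f (Sup I) - f (Inf I))) < e"
    by (elim exE conjE)
  have step: "norm (f t - f s) < e" if "a \<le> s" "s \<le> t" "t \<le> b" "t - s < d" for s t
  proof -
    have "{{s..t}} division_of {s..t}"
      using that division_of_self[of s t] by simp
    with d(2)[rule_format, of "{{s..t}}" "{s..t}"] that show ?thesis by simp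
  qed
  show "\<exists>d>0. \<forall>y\<in>{a..b}. dist y x < d \<longrightarrow> dist (f y) (f x) < e"
  proof (intro exI[of _ d] conjI ballI impI)
    fix y assume y: "y \<in> {a..b}" "dist y x < d"
    show "dist (f y) (f x) < e"
    proof (cases "x \<le> y")
      case True
      then show ?thesis using step[of x y] x y by (simp add: dist_norm)
    next
      case False
      then show ?thesis using step[of y x] x y by (simp add: dist_norm norm_minus_commute)
    qed
  qed (rule d(1))
qed

lemma set_integrable_Pair:
  fixes f :: "'a \<Rightarrow> 'b::{banach, second_countable_topology}" and g :: "'a \<Rightarrow> 'c::{banach, second_countable_topology}"
  assumes "set_integrable M A f" "set_integrable M A g"
  shows "set_integrable M A (\<lambda>x. (f x, g x))"
proof -
  have "integrable M (\<lambda>x. (indicator A x *\<^sub>R f x, 0) + (0, indicator A x *\<^sub>R g x))"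
    using assms unfolding set_integrable_def
    by (intro Bochner_Integration.integrable_add
        integrable_bounded_linear[OF bounded_linear_Pair[OF bounded_linear_ident bounded_linear_zero]]
        integrable_bounded_linear[OF bounded_linear_Pair[OF bounded_linear_zero bounded_linear_ident]])
  then show ?thesis by (simp add: set_integrable_def)
qed

lemma set_integral_Pair:
  fixes f :: "'a \<Rightarrow> 'b::{banach, second_countable_topology}" and g :: "'a \<Rightarrow> 'c::{banach, second_countable_topology}"
  assumes "set_integrable M A f" "set_integrable M A g"
  shows "(LINT x:A|M. (f x, g x)) = (LINT x:A|M. f x, LINT x:A|M. g x)"
proof (rule prod_eqI)
  note int = set_integrable_Pair[OF assms, unfolded set_integrable_def]
  show "fst (LINT x:A|M. (f x, g x)) = fst (LINT x:A|M. f x, LINT x:A|M. g x)"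
    using integral_bounded_linear[OF bounded_linear_fst int] by (simp add: set_lebesgue_integral_def)
  show "snd (LINT x:A|M. (f x, g x)) = snd (LINT x:A|M. f x, LINT x:A|M. g x)"
    using integral_bounded_linear[OF bounded_linear_snd int] by (simp add: set_lebesgue_integral_def)
qed

lemma set_integral_diff_initial:
  fixes f :: "real \<Rightarrow> 'a::{banach, second_countable_topology}"
  assumes f: "set_integrable lebesgue {a..b} f" and st: "a \<le> s" "s \<le> t" "t \<le> b"
  shows "(LINT \<tau>:{a..t}|lebesgue. f \<tau>) - (LINT \<tau>:{a..s}|lebesgue. f \<tau>) = (LINT \<tau>:{s<..t}|lebesgue. f \<tau>)"
proof -
  have "{a..t} = {a..s} \<union> {s<..t}" using st by auto
  moreover have "(LINT \<tau>:{a..s} \<union> {s<..t}|lebesgue. f \<tau>)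
      = (LINT \<tau>:{a..s}|lebesgue. f \<tau>) + (LINT \<tau>:{s<..t}|lebesgue. f \<tau>)"
    using st by (intro set_integral_Un set_integrable_subset[OF f]) auto
  ultimately show ?thesis by simp
qed

lemma gradient_eq:
  assumes "GDERIV f x :> g"
  shows "gradient f x = g"
proof -
  have "h = g" if "GDERIV f x :> h" for h
  proof -
    have "(\<lambda>y. y \<bullet> h) = (\<lambda>y. y \<bullet> g)"
      using that assms has_derivative_unique unfolding gderiv_def by blast
    then have "y \<bullet> (h - g) = 0" for y by (metis inner_diff_right right_minus_eq)
    then show ?thesis by (metis inner_eq_zero_iff right_minus_eq)
  qed
  with assms have "(THE g. GDERIV f x :> g) = g" by blast
  with assms show ?thesis unfolding gradient_def by auto
qed

text \<open>The chain rule with the embedding of a time slice identifies the space gradient of the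
  hypothesis as a component of \<open>dist_grad\<close>.\<close>

lemma gradient_infdist_slice:
  fixes S :: "(real \<times> 'a::euclidean_space) set"
  assumes "compact S" "S \<noteq> {}" "(t, x) \<notin> multi_nearest S" "infdist (t, x) S > 0"
  shows "gradient (\<lambda>y. infdist (t, y) S) x = snd (dist_grad S (t, x))"
proof (rule gradient_eq)
  have "((\<lambda>y. (t, y)) has_derivative (\<lambda>h. (0, h))) (at x)"
    by (intro has_derivative_Pair has_derivative_const has_derivative_ident)
  from has_derivative_compose[OF this] GDERIV_infdist[OF assms]
  have "((\<lambda>y. infdist (t, y) S) has_derivative (\<lambda>h. (0, h) \<bullet> dist_grad S (t, x))) (at x)"
    unfolding gderiv_def by blast
  then show "GDERIV (\<lambda>y. infdist (t, y) S) x :> snd (dist_grad S (t, x))"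
    unfolding gderiv_def by (simp add: inner_prod_def)
qed

text \<open>A Lebesgue measurable function composed with a trajectory need not be measurable, so the
  conclusion is stated through a measurable \<open>m\<close> that agrees with the product at almost
  every time.\<close>

lemma flow_Lp_Lq_product_integrable:
  fixes X :: "real \<Rightarrow> 'a::euclidean_space \<Rightarrow> 'a" and f g :: "real \<Rightarrow> 'a \<Rightarrow> ereal"
  assumes p: "1 \<le> p" "1 / p + 1 / p' = 1" and q: "1 \<le> q" "1 / q + 1 / q' = 1"
    and f: "in_Lp_Lq_loc T p q f" and g: "in_Lp_Lq_loc T p' q' g"
    and T: "T > 0"
    and cont: "AE x in lebesgue. continuous_on {0..T} (\<lambda>t. X t x)"
    and X: "\<And>t. t \<in> {0..T} \<Longrightarrow> X t \<in> borel_measurable lebesgue"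
    and L: "\<And>B t. B \<in> sets borel \<Longrightarrow> t \<in> {0..T} \<Longrightarrow> emeasure lebesgue (X t -` B) \<le> L * emeasure lborel B"
      "L < top"
  shows "AE x in lebesgue. \<exists>m\<in>borel_measurable lborel. (\<integral>\<^sup>+t. m t \<partial>lborel) < top \<and>
    (AE t in lborel. t \<in> {0<..<T} \<longrightarrow> e2ennreal \<bar>f t (X t x)\<bar> * e2ennreal \<bar>g t (X t x)\<bar> = m t)"
proof -
  obtain Y where Y: "Y \<in> borel_measurable (lborel \<Otimes>\<^sub>M lebesgue)"
    "AE x in lebesgue. \<forall>t\<in>{0..T}. Y (t, x) = X t x"
    by (rule flow_jointly_measurable_version[OF T cont X])
  define F where "F z = indicator ({0<..<T} \<times> UNIV) z * (e2ennreal \<bar>case_prod f z\<bar> * e2ennreal \<bar>case_prod g z\<bar>)" for z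
  have [measurable]: "case_prod f \<in> borel_measurable (lebesgue_on ({0<..<T} \<times> UNIV))"
    "case_prod g \<in> borel_measurable (lebesgue_on ({0<..<T} \<times> UNIV))"
    using f g by (auto simp: in_Lp_Lq_loc_def)
  have "F \<in> borel_measurable lebesgue"
    unfolding F_def by (intro measurable_indicator_extend open_strip_lebesgue) measurable
  then obtain F0 where F0: "F0 \<in> borel_measurable lborel" "AE z in lborel. F z = F0 z"
    using completion_ex_borel_measurable by blast
  obtain N where N: "{z. F z \<noteq> F0 z} \<subseteq> N" "N \<in> null_sets lborel"
    using F0(2) unfolding eventually_ae_filter by auto
  \<comment> \<open>Integrability is only local in space, hence the cut-off. Integer radii allow the
    exceptional sets of starting points to be united.\<close>
  define G where "G R z = F0 z * indicator (cball 0 (real R)) (snd z)" for R :: nat and z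
  have Gm: "G R \<in> borel_measurable borel" for R
  proof -
    have "snd \<in> borel_measurable (borel :: (real \<times> 'a) measure)"
      by (intro borel_measurable_continuous_onI continuous_on_snd continuous_on_id)
    then have "(\<lambda>z::real \<times> 'a. indicator (cball 0 (real R)) (snd z) :: ennreal) \<in> borel_measurable borel"
      by (rule measurable_compose) (intro borel_measurable_indicator borel_closed closed_cball)
    then show ?thesis unfolding G_def using F0(1) by simp
  qed
  have Gfin: "(\<integral>\<^sup>+z. G R z \<partial>lborel) < top" for R
  proof -
    let ?K = "cball (0::'a) (real R)"
    \<comment> \<open>The Borel version \<open>F0\<close> is needed for composition with the flow,
      but the mixed norms concern \<open>f\<close> and \<open>g\<close>; the two are matched section
      by section.\<close>
    have "AE z in lborel \<Otimes>\<^sub>M lborel. F z = F0 z"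
      unfolding lborel_prod by (rule F0(2))
    then have AEp: "AE t in lborel. AE y in lborel. F (t, y) = F0 (t, y)"
      by (rule lborel_pair.AE_pair)
    have "(\<integral>\<^sup>+z. G R z \<partial>lborel) = (\<integral>\<^sup>+z. G R z \<partial>(lborel \<Otimes>\<^sub>M lborel))"
      by (simp add: lborel_prod)
    also have "\<dots> = (\<integral>\<^sup>+t. \<integral>\<^sup>+y. G R (t, y) \<partial>lborel \<partial>lborel)"
      by (rule lborel.nn_integral_fst[symmetric]) (use Gm in \<open>simp add: lborel_prod\<close>)
    also have "\<dots> = (\<integral>\<^sup>+t. indicator {0<..<T} t *
        (\<integral>\<^sup>+y. indicator ?K y * (e2ennreal \<bar>f t y\<bar> * e2ennreal \<bar>g t y\<bar>) \<partial>lborel) \<partial>lborel)"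
    proof (rule nn_integral_cong_AE)
      show "AE t in lborel. (\<integral>\<^sup>+y. G R (t, y) \<partial>lborel) = indicator {0<..<T} t *
        (\<integral>\<^sup>+y. indicator ?K y * (e2ennreal \<bar>f t y\<bar> * e2ennreal \<bar>g t y\<bar>) \<partial>lborel)"
        using AEp
      proof eventually_elim
        case (elim t)
        have "(\<integral>\<^sup>+y. G R (t, y) \<partial>lborel) = (\<integral>\<^sup>+y. F (t, y) * indicator ?K y \<partial>lborel)"
          by (rule nn_integral_cong_AE) (use elim in eventually_elim, simp add: G_def)
        also have "\<dots> = indicator {0<..<T} t *
          (\<integral>\<^sup>+y. indicator ?K y * (e2ennreal \<bar>f t y\<bar> * e2ennreal \<bar>g t y\<bar>) \<partial>lborel)"
          by (cases "t \<in> {0<..<T}") (simp_all add: F_def indicator_times mult.commute)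
        finally show ?case .
      qed
    qed
    also have "\<dots> < top"
      by (rule in_Lp_Lq_loc_mult_finite[OF p q f g compact_cball])
    finally show ?thesis .
  qed
  have "AE x in lebesgue. \<forall>R. (\<integral>\<^sup>+t. indicator {0..T} t * G R (t, Y (t, x)) \<partial>lborel) < top"
    unfolding AE_all_countable
    using flow_AE_nn_integral_finite[OF X L(1) Y Gm L(2) Gfin] by blast
  moreover have "AE x in lebesgue. AE t in lborel. t \<in> {0..T} \<longrightarrow> (t, X t x) \<notin> N"
    by (rule flow_AE_avoids_null_set[OF X L(1) Y N(2)])
  ultimately show ?thesis
    using Y(2) cont
  proof eventually_elim
    case (elim x)
    \<comment> \<open>A single continuous trajectory stays in one ball over the whole time interval,
      so some radius \<open>R\<close>, depending on \<open>x\<close>, makes the cut-off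
      invisible.\<close>
    have "bounded ((\<lambda>t. X t x) ` {0..T})"
      by (intro compact_imp_bounded compact_continuous_image elim) simp
    then obtain C where C: "\<And>t. t \<in> {0..T} \<Longrightarrow> norm (X t x) \<le> C"
      unfolding bounded_iff by blast
    obtain R :: nat where R: "C \<le> real R" using real_arch_simple by blast
    define m where "m t = indicator {0..T} t * G R (t, Y (t, x))" for t
    have "m \<in> borel_measurable lborel"
      unfolding m_def by (rule flow_section_measurable[OF Y(1) Gm])
    moreover have "(\<integral>\<^sup>+t. m t \<partial>lborel) < top"
      using elim(1) by (simp add: m_def)
    moreover have "AE t in lborel. t \<in> {0<..<T} \<longrightarrow> e2ennreal \<bar>f t (X t x)\<bar> * e2ennreal \<bar>g t (X t x)\<bar> = m t"
      using elim(2)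
    proof eventually_elim
      case (elim t)
      show ?case
      proof
        assume t: "t \<in> {0<..<T}"
        then have t': "t \<in> {0..T}" by simp
        then have "F (t, X t x) = F0 (t, X t x)" using elim N(1) by blast
        moreover have "X t x \<in> cball 0 (real R)" using C[OF t'] R by simp
        moreover have "Y (t, x) = X t x" using t' \<open>\<forall>t\<in>{0..T}. Y (t, x) = X t x\<close> by blast
        ultimately show "e2ennreal \<bar>f t (X t x)\<bar> * e2ennreal \<bar>g t (X t x)\<bar> = m t"
          using t t' by (simp add: m_def G_def F_def)
      qed
    qed
    ultimately show ?case by blast
  qed
qed

theorem theorem1p22:
  fixes T :: real
    and S :: "(real \<times> (real ^ 'n)) set"
    and b :: "real \<Rightarrow> real ^ 'n \<Rightarrow> real ^ 'n"
    and X :: "real \<Rightarrow> real ^ 'n \<Rightarrow> real ^ 'n"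
    and p q p' q' :: ennreal
  assumes "T > 0"
    and "compact S" and "S \<subseteq> {0..T} \<times> UNIV"
    and "1 \<le> p" and "1 \<le> q"
    and "1 / p + 1 / p' = 1" and "1 / q + 1 / q' = 1"
    and "in_Lp_Lq_loc T p q (\<lambda>t x. ereal (b t x \<bullet> gradient (\<lambda>y. infdist (t, y) S) x))"
    and "in_Lp_Lq_loc T p' q' (\<lambda>t x. inverse (ereal (infdist (t, x) S)))"
    and "regular_Lagrangian_flow T b X"
  shows "{x. \<exists>t\<in>{0..T}. (t, X t x) \<in> S} \<in> null_sets lebesgue"
proof (cases "S = {}")
  case True
  then show ?thesis by simp
next
  \<comment> \<open>For empty \<open>S\<close> the distance is 0 by convention and there are no
    nearest points, so that case is split off.\<close>
  case S: False
  note T = \<open>T > 0\<close>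
  \<comment> \<open>The trajectory lifted to space-time, where its velocity has time component
    1.\<close>
  let ?z = "\<lambda>x t. (t, X t x)" and ?v = "\<lambda>x t. (1::real, b t (X t x))"
  let ?d = "\<lambda>x t. infdist (t, X t x) S"
  obtain L :: real where L: "L > 0" "\<forall>B\<in>sets borel. \<forall>t\<in>{0..T}. X t -` B \<in> sets lebesgue \<and>
      emeasure lebesgue (X t -` B) \<le> ennreal L * emeasure lebesgue B"
    using assms(10) unfolding regular_Lagrangian_flow_def by auto
  have flow: "AE x in lebesgue. absolutely_continuous_on {0..T} (\<lambda>t. X t x) \<and>
        set_integrable lebesgue {0..T} (\<lambda>\<tau>. b \<tau> (X \<tau> x)) \<and>
        (\<forall>t\<in>{0..T}. X t x = x + (LINT \<tau>:{0..t}|lebesgue. b \<tau> (X \<tau> x)))"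
    using assms(10) unfolding regular_Lagrangian_flow_def by simp
  have Xm: "X t \<in> borel_measurable lebesgue" if "t \<in> {0..T}" for t
    using L(2) that by (intro measurableI) auto
  have Lb: "emeasure lebesgue (X t -` B) \<le> ennreal L * emeasure lborel B"
    if B: "B \<in> sets borel" "t \<in> {0..T}" for B t
  proof -
    have "emeasure lebesgue (X t -` B) \<le> ennreal L * emeasure lebesgue B"
      using L(2) B by blast
    also have "emeasure lebesgue B = emeasure lborel B"
      using B(1) by simp
    finally show ?thesis .
  qed
  have cont: "AE x in lebesgue. continuous_on {0..T} (\<lambda>t. X t x)"
    using flow by eventually_elim (auto intro: absolutely_continuous_imp_continuous_on)
  obtain Y where Y: "Y \<in> borel_measurable (lborel \<Otimes>\<^sub>M lebesgue)"
    "AE x in lebesgue. \<forall>t\<in>{0..T}. Y (t, x) = X t x"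
    by (rule flow_jointly_measurable_version[OF T cont Xm])
  have uniq: "AE x in lebesgue. AE t in lborel. t \<in> {0..T} \<longrightarrow> (t, X t x) \<notin> multi_nearest S"
    by (rule flow_AE_avoids_null_set[OF Xm Lb Y multi_nearest_null_sets[OF \<open>compact S\<close>]])
  have pq: "0 < p" "0 < q" using \<open>1 \<le> p\<close> \<open>1 \<le> q\<close> by (auto intro: less_le_trans[OF zero_less_one])
  \<comment> \<open>To be used with the constant 1 and with the pairing of \<open>b\<close> and the
    gradient; the two results are \<open>m1\<close> and \<open>m2\<close>.\<close>
  have prod: "AE x in lebesgue. \<exists>m\<in>borel_measurable lborel. (\<integral>\<^sup>+t. m t \<partial>lborel) < top \<and>
      (AE t in lborel. t \<in> {0<..<T} \<longrightarrow>
        e2ennreal \<bar>f t (X t x)\<bar> * e2ennreal \<bar>inverse (ereal (?d x t))\<bar> = m t)"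
    if "in_Lp_Lq_loc T p q f" for f
    by (rule flow_Lp_Lq_product_integrable[OF assms(4,6,5,7) that assms(9) T cont Xm Lb ennreal_less_top])
  have "AE x in lebesgue. \<forall>t\<in>{0..T}. (t, X t x) \<notin> S"
    using flow cont uniq prod[OF in_Lp_Lq_loc_one[OF pq]] prod[OF assms(8)]
  proof eventually_elim
    case (elim x)
    obtain m1 where m1: "m1 \<in> borel_measurable lborel" "(\<integral>\<^sup>+t. m1 t \<partial>lborel) < top"
      "AE t in lborel. t \<in> {0<..<T} \<longrightarrow> e2ennreal \<bar>1\<bar> * e2ennreal \<bar>inverse (ereal (?d x t))\<bar> = m1 t"
      using elim(4) by blast
    obtain m2 where m2: "m2 \<in> borel_measurable lborel" "(\<integral>\<^sup>+t. m2 t \<partial>lborel) < top"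
      "AE t in lborel. t \<in> {0<..<T} \<longrightarrow>
        e2ennreal \<bar>ereal (b t (X t x) \<bullet> gradient (\<lambda>y. infdist (t, y) S) (X t x))\<bar>
          * e2ennreal \<bar>inverse (ereal (?d x t))\<bar> = m2 t"
      using elim(5) by blast
    have one: "e2ennreal \<bar>1\<bar> = 1" by (simp add: one_ereal_def)
    have inv: "e2ennreal \<bar>inverse (ereal r)\<bar> = ennreal (1 / r)" if "r > 0" for r
      using that by (simp add: divide_inverse)
    have b_int: "set_integrable lebesgue {0..T} (\<lambda>\<tau>. b \<tau> (X \<tau> x))" using elim(1) by blast
    have one_int: "set_integrable lebesgue {0..T} (\<lambda>\<tau>. 1::real)"
      using integrable_real_indicator[of "{0..T}" lebesgue] T by (simp add: set_integrable_def)
    have v_int: "set_integrable lebesgue {0..T} (?v x)"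
      by (rule set_integrable_Pair[OF one_int b_int])
    have incr: "?z x t - ?z x s = (LINT \<tau>:{s<..t}|lebesgue. ?v x \<tau>)" if "0 \<le> s" "s \<le> t" "t \<le> T" for s t
    proof -
      have sub: "set_integrable lebesgue {s<..t} (\<lambda>\<tau>. 1::real)"
        "set_integrable lebesgue {s<..t} (\<lambda>\<tau>. b \<tau> (X \<tau> x))"
        using that by (auto intro!: set_integrable_subset[OF one_int] set_integrable_subset[OF b_int])
      have "X t x - X s x = (LINT \<tau>:{0..t}|lebesgue. b \<tau> (X \<tau> x)) - (LINT \<tau>:{0..s}|lebesgue. b \<tau> (X \<tau> x))"
      proof -
        have "X r x = x + (LINT \<tau>:{0..r}|lebesgue. b \<tau> (X \<tau> x))" if "0 \<le> r" "r \<le> T" for r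
          using elim(1) that by simp
        from this[of t] this[of s] that show ?thesis by simp
      qed
      also have "\<dots> = (LINT \<tau>:{s<..t}|lebesgue. b \<tau> (X \<tau> x))"
        by (rule set_integral_diff_initial[OF b_int that])
      finally have "X t x - X s x = (LINT \<tau>:{s<..t}|lebesgue. b \<tau> (X \<tau> x))" .
      moreover have "t - s = (LINT \<tau>:{s<..t}|lebesgue. 1::real)"
        using that by (simp add: set_lebesgue_integral_def)
      ultimately show ?thesis
        by (simp add: set_integral_Pair[OF sub])
    qed
    have z_cont: "continuous_on {0..T} (?z x)"
      by (intro continuous_on_Pair continuous_on_id elim(2))
    have uniq_x: "AE \<tau> in lebesgue. \<tau> \<in> {0..T} \<longrightarrow> ?z x \<tau> \<notin> multi_nearest S"
      by (rule AE_completion[OF elim(3)])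
    \<comment> \<open>The hypotheses concern the open time interval, the estimate along the curve
      the closed one; the end points are negligible.\<close>
    have "AE \<tau> in lborel. \<tau> \<notin> {0, T}"
      by (rule AE_not_in) (simp add: countable_imp_null_set_lborel)
    then have "AE \<tau> in lborel. \<tau> \<in> {0..T} \<longrightarrow> ?d x \<tau> > 0 \<longrightarrow>
        ennreal \<bar>log_dist_grad S (?z x \<tau>) \<bullet> ?v x \<tau>\<bar> \<le> m1 \<tau> + m2 \<tau>"
      using m1(3) m2(3) elim(3)
    proof eventually_elim
      case (elim \<tau>)
      show ?case
      proof (intro impI)
        assume \<tau>: "\<tau> \<in> {0..T}" and pos: "?d x \<tau> > 0"
        define D where "D = dist_grad S (?z x \<tau>)"
        define \<beta> where "\<beta> = b \<tau> (X \<tau> x)"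
        have in0T: "\<tau> \<in> {0<..<T}" using \<tau> elim(1) by auto
        have nm: "?z x \<tau> \<notin> multi_nearest S" using elim(4) \<tau> by blast
        have grad: "gradient (\<lambda>y. infdist (\<tau>, y) S) (X \<tau> x) = snd D"
          unfolding D_def by (rule gradient_infdist_slice[OF \<open>compact S\<close> S nm pos])
        have "norm D = 1"
          unfolding D_def by (rule norm_dist_grad[OF compact_imp_closed[OF \<open>compact S\<close>] S pos])
        \<comment> \<open>The time component of a unit vector: this is the bound that
          \<open>m1\<close> pays for.\<close>
        then have "\<bar>fst D\<bar> \<le> 1" using norm_fst_le[of "fst D" "snd D"] by simp
        moreover have "D \<bullet> ?v x \<tau> = fst D + \<beta> \<bullet> snd D"
          by (simp add: inner_prod_def \<beta>_def inner_commute)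
        ultimately have "\<bar>D \<bullet> ?v x \<tau>\<bar> \<le> 1 + \<bar>\<beta> \<bullet> snd D\<bar>" by linarith
        then have "\<bar>D \<bullet> ?v x \<tau>\<bar> * (1 / ?d x \<tau>) \<le> (1 + \<bar>\<beta> \<bullet> snd D\<bar>) * (1 / ?d x \<tau>)"
          using pos by (intro mult_right_mono) auto
        moreover have "\<bar>log_dist_grad S (?z x \<tau>) \<bullet> ?v x \<tau>\<bar> = \<bar>D \<bullet> ?v x \<tau>\<bar> * (1 / ?d x \<tau>)"
          using pos unfolding log_dist_grad_def D_def[symmetric] inner_scaleR_left abs_mult
          by (simp add: divide_inverse mult.commute)
        ultimately have "\<bar>log_dist_grad S (?z x \<tau>) \<bullet> ?v x \<tau>\<bar> \<le> 1 / ?d x \<tau> + \<bar>\<beta> \<bullet> snd D\<bar> * (1 / ?d x \<tau>)"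
          by (simp add: add_divide_distrib)
        then have "ennreal \<bar>log_dist_grad S (?z x \<tau>) \<bullet> ?v x \<tau>\<bar>
            \<le> ennreal (1 / ?d x \<tau> + \<bar>\<beta> \<bullet> snd D\<bar> * (1 / ?d x \<tau>))"
          by (rule ennreal_leI)
        also have "\<dots> = ennreal (1 / ?d x \<tau>) + ennreal (\<bar>\<beta> \<bullet> snd D\<bar> * (1 / ?d x \<tau>))"
          using pos by (intro ennreal_plus) simp_all
        also have "ennreal (\<bar>\<beta> \<bullet> snd D\<bar> * (1 / ?d x \<tau>)) = ennreal \<bar>\<beta> \<bullet> snd D\<bar> * ennreal (1 / ?d x \<tau>)"
          using pos by (intro ennreal_mult) simp_all
        also have "ennreal (1 / ?d x \<tau>) = m1 \<tau>"
          using elim(2) in0T inv[OF pos] one by simp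
        also have "ennreal \<bar>\<beta> \<bullet> snd D\<bar> * m1 \<tau> = m2 \<tau>"
          using elim(2,3) in0T one grad by (simp add: \<beta>_def)
        finally show "ennreal \<bar>log_dist_grad S (?z x \<tau>) \<bullet> ?v x \<tau>\<bar> \<le> m1 \<tau> + m2 \<tau>" .
      qed
    qed
    then have m: "AE \<tau> in lebesgue. \<tau> \<in> {0..T} \<longrightarrow> ?d x \<tau> > 0 \<longrightarrow>
        ennreal \<bar>log_dist_grad S (?z x \<tau>) \<bullet> ?v x \<tau>\<bar> \<le> m1 \<tau> + m2 \<tau>"
      by (rule AE_completion)
    have "(\<integral>\<^sup>+\<tau>. indicator {0..T} \<tau> * (m1 \<tau> + m2 \<tau>) \<partial>lebesgue) \<le> (\<integral>\<^sup>+\<tau>. m1 \<tau> + m2 \<tau> \<partial>lborel)"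
      unfolding nn_integral_completion by (intro nn_integral_mono) (auto simp: indicator_def)
    also have "\<dots> = (\<integral>\<^sup>+\<tau>. m1 \<tau> \<partial>lborel) + (\<integral>\<^sup>+\<tau>. m2 \<tau> \<partial>lborel)"
      by (rule nn_integral_add[OF m1(1) m2(1)])
    also have "\<dots> < top" using m1(2) m2(2) by simp
    finally have fin: "(\<integral>\<^sup>+\<tau>. indicator {0..T} \<tau> * (m1 \<tau> + m2 \<tau>) \<partial>lebesgue) < top" .
    have "\<exists>t0\<in>{0..T}. ?d x t0 > 0"
    proof (rule ccontr)
      \<comment> \<open>In \<open>ereal\<close> the inverse of 0 is infinite, so a trajectory in
        \<open>S\<close> at all times would make the integrable function \<open>m1\<close> infinite
        almost everywhere on a set of measure \<open>T > 0\<close>.\<close>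
      assume none: "\<not> ?thesis"
      have zero: "?d x t = 0" if "t \<in> {0..T}" for t
      proof -
        have "\<not> ?d x t > 0" using none that by blast
        then show ?thesis using infdist_nonneg[of "(t, X t x)" S] by linarith
      qed
      have "AE t in lborel. m1 t \<noteq> top"
        using nn_integral_PInf_AE[OF m1(1)] m1(2) by (simp add: less_top)
      then have "AE t in lborel. t \<notin> {0<..<T}"
        using m1(3)
      proof eventually_elim
        case (elim t)
        show ?case
        proof
          assume t: "t \<in> {0<..<T}"
          then have "?d x t = 0" by (intro zero) simp
          then have "m1 t = top" using elim(2) t one by simp
          then show False using elim(1) by simp
        qed
      qed
      then have "emeasure lborel {0<..<T} = 0"
        by (subst (asm) AE_iff_measurable[of "{0<..<T}"]) auto
      then show False using T by simp
    qed
    then obtain t0 where t0: "t0 \<in> {0..T}" "?d x t0 > 0" by blast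
    show ?case
    proof
      fix t assume "t \<in> {0..T}"
      with infdist_pos_along_curve[OF \<open>compact S\<close> S v_int incr z_cont uniq_x m fin t0]
      have "?d x t > 0" by blast
      then show "(t, X t x) \<notin> S" by auto
    qed
  qed
  then have "AE x in lebesgue. x \<notin> {x. \<exists>t\<in>{0..T}. (t, X t x) \<in> S}"
    by eventually_elim blast
  then show ?thesis
    by (simp add: completion.AE_iff_null_sets)
qed

end
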